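(* Let $d\ge 2$ be an even integer, let $k$ be an integer with $k>d/2$, and put $\lambda=(d-2)/2$. If $\rho>0$ is chosen so that $$\log\rho=-\tfrac12\,\tau(k-d/2,\,j,\,\lambda)\quad\text{for some integer } j \text{ with } 0\le j\le k-d/2,$$ then the set $A(\mathcal{S}^{d-1}(\rho),\phi_{d,k})=\{\phi_{d,k}(|\cdot-y|) : y\in\mathcal{S}^{d-1}(\rho)\}$ is not fundamental in $\mathbf{C}(\mathcal{S}^{d-1}(\rho))$.
   Context: $|\cdot|$ is the Euclidean norm on $\mathbb{R}^d$, $\mathcal{S}^{d-1}(\rho)=\{x\in\mathbb{R}^d : |x|=\rho\}$, and $\mathbf{C}(\mathcal{S}^{d-1}(\rho))$ is the space of real-valued continuous functions on it with the uniform norm. For even $d$ and integer $k>d/2$, the polyharmonic spline is $\phi_{d,k}(r)=r^{2k-d}\log r$ for $r>0$, $\phi_{d,k}(0)=0$. With the digamma function $\Psi(t)=\Gamma'(t)/\Gamma(t)$, $$\tau(\beta,j,\lambda)=\log 4+\Psi(\beta+1)+\Psi(\beta+\lambda+\tfrac12)-\Psi(\beta-j+1)-\Psi(\beta+j+2\lambda+1).$$ A set $A$ is fundamental in a normed vector space $X$ if for every $x\in X$ and $\epsilon>0$ there exist a finite subset $Y\subset A$ and coefficients $a_y$, $y\in Y$, such that $\|x-\sum_{y\in Y}a_y y\|<\epsilon$; here the functions $\phi_{d,k}(|\cdot-y|)$ are regarded as restricted to $\mathcal{S}^{d-1}(\rho)$. *)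

theory Defs
  imports "HOL-Analysis.Analysis"
begin

definition polyharmonic_spline :: "nat \<Rightarrow> int \<Rightarrow> real \<Rightarrow> real" where
  "polyharmonic_spline d k r = (if r = 0 then 0 else r powi (2 * k - int d) * ln r)"

definition tau :: "real \<Rightarrow> int \<Rightarrow> real \<Rightarrow> real" where
  "tau \<beta> j l =
     ln 4 + Digamma (\<beta> + 1) + Digamma (\<beta> + l + 1 / 2)
       - Digamma (\<beta> - of_int j + 1) - Digamma (\<beta> + of_int j + 2 * l + 1)"

text \<open>
  A real function on a set \<open>S\<close> is represented by its extension by \<open>0\<close> outside \<open>S\<close>. These
  extensions are closed under the pointwise operations, so the space of continuous functions
  on \<open>S\<close> is a linear subspace of the functions on the ambient type, and for compact nonempty
  \<open>S\<close> the uniform norm is a genuine norm on it.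
\<close>

definition zero_ext :: "'a set \<Rightarrow> ('a \<Rightarrow> real) \<Rightarrow> 'a \<Rightarrow> real" where
  "zero_ext S f = (\<lambda>x. if x \<in> S then f x else 0)"

definition cont_functions :: "'a::topological_space set \<Rightarrow> ('a \<Rightarrow> real) set" where
  "cont_functions S = {f. continuous_on S f \<and> (\<forall>x. x \<notin> S \<longrightarrow> f x = 0)}"

definition uniform_norm :: "'a set \<Rightarrow> ('a \<Rightarrow> real) \<Rightarrow> real" where
  "uniform_norm S f = (SUP x\<in>S. \<bar>f x\<bar>)"

text \<open>
  Here \<open>X\<close> is the carrier of a space of real functions with pointwise operations and
  \<open>N\<close> is its norm.
\<close>

definition fundamental_in ::
    "('a \<Rightarrow> real) set \<Rightarrow> (('a \<Rightarrow> real) \<Rightarrow> real) \<Rightarrow> ('a \<Rightarrow> real) set \<Rightarrow> bool" where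
  "fundamental_in X N A \<longleftrightarrow>
     (\<forall>f\<in>X. \<forall>\<epsilon>>0. \<exists>Y a. finite Y \<and> Y \<subseteq> A \<and>
        N (\<lambda>x. f x - (\<Sum>g\<in>Y. a g * g x)) < \<epsilon>)"

definition radial_translates ::
    "'a::real_normed_vector set \<Rightarrow> (real \<Rightarrow> real) \<Rightarrow> ('a \<Rightarrow> real) set" where
  "radial_translates S \<phi> = {zero_ext S (\<lambda>x. \<phi> (norm (x - y))) | y. y \<in> S}"

end

theory Submission
  imports Defs "HOL-Computational_Algebra.Polynomial"
begin

text \<open>
  Write \<open>\<beta> = k - d/2\<close>, \<open>\<lambda> = d/2 - 1\<close>. For unit vectors \<open>x, y\<close> one has
  \<open>|\<rho>x - \<rho>y|\<^sup>2 = 2\<rho>\<^sup>2(1 - t)\<close> with \<open>t = x \<bullet> y\<close>, so on the sphere of radius \<open>\<rho>\<close> the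
  spline is a positive multiple of the zonal kernel
  \<open>(1 - t)\<^sup>\<beta> (2 ln \<rho> + ln 2 + ln (1 - t))\<close>. Integrating a zonal kernel against a spherical
  harmonic \<open>H\<close> of degree \<open>j\<close> returns a multiple of \<open>H\<close> (Funk and Hecke). The idea is
  that the given value of \<open>\<rho>\<close> makes this multiple vanish: then the nonzero continuous functional
  \<open>f \<mapsto> \<integral> f(\<rho>x) H(x)\<close> annihilates every translate, and the span of the translates cannot be dense.

  The harmonic is \<open>H(x) = (x \<bullet> a + i x \<bullet> b)\<^sup>j\<close> with \<open>a, b\<close> orthonormal. For it the Funk-Hecke
  formula on monomials needs nothing but rotation invariance: \<open>\<integral> (x \<bullet> v)\<^sup>N\<close> depends only on
  \<open>v \<bullet> v\<close>, and this polynomial identity persists for the complex vectors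
  \<open>v = y + u(a + ib)\<close>, where \<open>v \<bullet> v = 1 + 2u(y \<bullet> a + i y \<bullet> b)\<close> because \<open>a + ib\<close> is
  isotropic. Comparing coefficients of \<open>u\<^sup>j\<close> evaluates \<open>\<integral> t\<^sup>n H\<close>
  (\<open>isotropic_moment\<close>). A recursion in \<open>n\<close> identifies the result with the moments of a
  symmetric beta weight, which amounts to Rodrigues' formula and integration by parts
  (\<open>monomial_funk_hecke\<close>). The binomial series extends the formula to
  \<open>(1 - t) powr s\<close>, whose multiplier is an explicit quotient of Gamma values
  (\<open>powr_funk_hecke\<close>). Its logarithmic derivative at \<open>s = \<beta>\<close> is \<open>\<tau> - ln 2\<close>
  (\<open>eigenvalue_derivative\<close>), so the multiplier of
  \<open>(1 - t)\<^sup>\<beta> (c + ln (1 - t))\<close> is proportional to \<open>\<tau> - ln 2 + c\<close>. For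
  \<open>c = 2 ln \<rho> + ln 2\<close> this is \<open>\<tau> + 2 ln \<rho> = 0\<close> (\<open>log_kernel_annihilated\<close>).
\<close>

section \<open>Orthogonal invariance of Lebesgue measure\<close>

lemma lborel_translate:
  fixes f :: "'a::euclidean_space \<Rightarrow> ennreal"
  assumes [measurable]: "f \<in> borel_measurable borel"
  shows "(\<integral>\<^sup>+x. f (x + y) \<partial>lborel) = (\<integral>\<^sup>+x. f x \<partial>lborel)"
proof -
  have "(\<integral>\<^sup>+x. f x \<partial>lborel) = (\<integral>\<^sup>+x. f x \<partial>(distr lborel borel ((+) y)))"
    by (simp add: lborel_distr_plus)
  also have "\<dots> = (\<integral>\<^sup>+x. f (x + y) \<partial>lborel)"
    by (subst nn_integral_distr) (auto simp: add.commute)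
  finally show ?thesis ..
qed

text \<open>
  Translation invariance determines Lebesgue measure up to a factor: for a second invariant measure
  \<open>\<mu>\<close>, Fubini applied to the indicator of \<open>x \<in> A\<close>, \<open>y - x \<in> B\<close> gives
  \<open>\<mu>(A) * lborel(B) = lborel(A) * \<mu>(- B)\<close>. With \<open>B\<close> the unit ball, which \<open>U\<close>
  preserves, the factor is 1.
\<close>

lemma lborel_distr_isometry:
  fixes U :: "'a::euclidean_space \<Rightarrow> 'a"
  assumes U: "orthogonal_transformation U"
  shows "distr lborel borel U = lborel"
proof -
  have linU: "linear U" using U by (rule orthogonal_transformation_linear)
  have [measurable]: "U \<in> borel_measurable borel"
    by (intro borel_measurable_continuous_onI linear_continuous_on linear_conv_bounded_linear[THEN iffD1] linU)
  have surjU: "surj U" using U orthogonal_transformation_surj by blast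
  define \<mu> where "\<mu> = distr lborel borel U"
  have \<mu>_int: "(\<integral>\<^sup>+x. f x \<partial>\<mu>) = (\<integral>\<^sup>+x. f (U x) \<partial>lborel)" if "f \<in> borel_measurable borel" for f
    unfolding \<mu>_def using that by (subst nn_integral_distr) auto
  have shift: "(\<integral>\<^sup>+x. f (x + y) \<partial>\<mu>) = (\<integral>\<^sup>+x. f x \<partial>\<mu>)"
    if [measurable]: "f \<in> borel_measurable borel" for f :: "'a \<Rightarrow> ennreal" and y
  proof -
    obtain u where u: "y = U u" using surjU by (metis surj_def)
    have "(\<integral>\<^sup>+x. f (x + y) \<partial>\<mu>) = (\<integral>\<^sup>+x. f (U (x + u)) \<partial>lborel)"
      by (subst \<mu>_int) (auto simp: u linear_add[OF linU])
    also have "\<dots> = (\<integral>\<^sup>+x. f (U x) \<partial>lborel)"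
      by (rule lborel_translate[of "\<lambda>x. f (U x)"]) simp
    finally show ?thesis by (simp add: \<mu>_int)
  qed
  define B :: "'a set" where "B = ball 0 1"
  have [measurable]: "B \<in> sets borel" by (simp add: B_def)
  have Bsym: "- x \<in> B \<longleftrightarrow> x \<in> B" for x by (simp add: B_def)
  have UB: "U x \<in> B \<longleftrightarrow> x \<in> B" for x
    by (simp add: B_def orthogonal_transformation_norm[OF U])
  have "(\<integral>\<^sup>+x. indicator B x \<partial>\<mu>) = (\<integral>\<^sup>+x. indicator B x \<partial>lborel)"
    by (subst \<mu>_int) (simp_all add: UB indicator_def[abs_def] cong: if_cong)
  then have \<mu>B: "emeasure \<mu> B = emeasure lborel B"
    by (simp add: \<mu>_def)
  have B_fin: "emeasure lborel B \<noteq> top" and B_pos: "emeasure lborel B \<noteq> 0"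
    using emeasure_bounded_finite[of B] content_ball_pos[of 1 "0::'a"]
    by (auto simp: B_def measure_def)
  have sfin: "sigma_finite_measure \<mu>"
  proof
    have "range (\<lambda>n. ball (0::'a) (real n)) \<subseteq> sets \<mu>" by (auto simp: \<mu>_def)
    moreover have "(\<Union>n. ball (0::'a) (real n)) = UNIV"
      by (auto simp: reals_Archimedean2)
    moreover have "emeasure \<mu> (ball 0 (real n)) \<noteq> \<infinity>" for n
    proof -
      have "emeasure \<mu> (ball 0 (real n)) = emeasure lborel (U -` ball 0 (real n))"
        unfolding \<mu>_def by (subst emeasure_distr) auto
      also have "U -` ball 0 (real n) = ball 0 (real n)"
        by (auto simp: orthogonal_transformation_norm[OF U])
      finally show ?thesis using emeasure_bounded_finite[of "ball (0::'a) (real n)"] by auto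
    qed
    ultimately show "\<exists>A. countable A \<and> A \<subseteq> sets \<mu> \<and> \<Union> A = space \<mu> \<and> (\<forall>a\<in>A. emeasure \<mu> a \<noteq> \<infinity>)"
      by (intro exI[of _ "range (\<lambda>n. ball (0::'a) (real n))"]) (auto simp: \<mu>_def)
  qed
  interpret pair_sigma_finite \<mu> "lborel :: 'a measure"
    using sfin by (simp add: pair_sigma_finite_def sigma_finite_lborel)
  have [measurable_cong]: "sets \<mu> = sets borel" by (simp add: \<mu>_def)
  have main: "emeasure \<mu> A = emeasure lborel A" if [measurable]: "A \<in> sets borel" for A
  proof -
    have "emeasure \<mu> A * emeasure lborel B = (\<integral>\<^sup>+x. indicator A x * (\<integral>\<^sup>+y. indicator B (y + - x) \<partial>lborel) \<partial>\<mu>)"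
      by (subst lborel_translate) (auto simp: nn_integral_multc)
    also have "\<dots> = (\<integral>\<^sup>+x. (\<integral>\<^sup>+y. indicator A x * indicator B (y - x) \<partial>lborel) \<partial>\<mu>)"
      by (simp add: nn_integral_cmult)
    also have "\<dots> = (\<integral>\<^sup>+y. (\<integral>\<^sup>+x. indicator A x * indicator B (y - x) \<partial>\<mu>) \<partial>lborel)"
      by (rule Fubini'[symmetric]) measurable
    also have "\<dots> = (\<integral>\<^sup>+y. (\<integral>\<^sup>+x. indicator A (x + y) * indicator B (y - (x + y)) \<partial>\<mu>) \<partial>lborel)"
      by (subst shift[of "\<lambda>x. indicator A x * indicator B (y - x)" y for y]) auto
    also have "\<dots> = (\<integral>\<^sup>+y. (\<integral>\<^sup>+x. indicator B x * indicator A (y + x) \<partial>\<mu>) \<partial>lborel)"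
      by (intro nn_integral_cong) (auto simp: indicator_def Bsym add.commute)
    also have "\<dots> = (\<integral>\<^sup>+x. (\<integral>\<^sup>+y. indicator B x * indicator A (y + x) \<partial>lborel) \<partial>\<mu>)"
      by (rule Fubini') measurable
    also have "\<dots> = (\<integral>\<^sup>+x. indicator B x * (\<integral>\<^sup>+y. indicator A (y + x) \<partial>lborel) \<partial>\<mu>)"
      by (simp add: nn_integral_cmult)
    also have "\<dots> = emeasure lborel A * emeasure \<mu> B"
      by (subst lborel_translate) (auto simp: nn_integral_multc mult.commute)
    finally have "emeasure lborel B * emeasure \<mu> A = emeasure lborel B * emeasure lborel A"
      by (simp add: \<mu>B mult.commute)
    then show ?thesis
      using B_fin B_pos by (simp add: ennreal_mult_cancel_left)
  qed
  show ?thesis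
    by (rule measure_eqI) (use main in \<open>auto simp: \<mu>_def\<close>)
qed


section \<open>The rotation invariant measure on the unit sphere\<close>

text \<open>
  A constant multiple of surface measure. Radial projection commutes with orthogonal maps, so the image
  of Lebesgue measure on the punctured ball inherits orthogonal invariance.
\<close>

definition sphere_measure :: "(real^'n) measure" where
  "sphere_measure = distr (restrict_space lborel (ball 0 1 - {0})) borel (\<lambda>x. x /\<^sub>R norm x)"

lemma sets_sphere_measure [simp, measurable_cong]: "sets sphere_measure = sets borel"
  by (simp add: sphere_measure_def)

lemma space_sphere_measure [simp]: "space sphere_measure = UNIV"
  by (simp add: sphere_measure_def)

lemma normalize_measurable [measurable]:
  "(\<lambda>x::real^'n. x /\<^sub>R norm x) \<in> measurable (restrict_space lborel (ball 0 1 - {0})) borel"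
  by (rule measurable_restrict_space1) simp

lemma finite_sphere_measure: "finite_measure (sphere_measure :: (real^'n) measure)"
proof -
  have "emeasure lborel (ball 0 1 - {0::real^'n}) \<noteq> \<infinity>"
    using emeasure_bounded_finite[of "ball (0::real^'n) 1 - {0}"]
    by (simp add: bounded_diff less_top)
  then have "finite_measure (restrict_space lborel (ball 0 1 - {0::real^'n}))"
    by (intro finite_measureI) (simp add: emeasure_restrict_space)
  then show ?thesis
    unfolding sphere_measure_def by (rule finite_measure.finite_measure_distr) measurable
qed

interpretation sphere_measure: finite_measure "sphere_measure :: (real^'n) measure"
  by (rule finite_sphere_measure)

lemma AE_sphere_measure: "AE x in sphere_measure. norm (x::real^'n) = 1"
  unfolding sphere_measure_def
  by (subst AE_distr_iff) (auto simp: AE_restrict_space_iff)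

lemma measure_sphere_measure_pos: "measure (sphere_measure :: (real^'n) measure) UNIV > 0"
proof -
  have "measure (sphere_measure :: (real^'n) measure) UNIV = measure lborel (ball 0 1 - {0::real^'n})"
    unfolding sphere_measure_def
    by (subst measure_distr) (auto simp: measure_restrict_space)
  also have "\<dots> = measure lborel (ball (0::real^'n) 1)"
    unfolding measure_def by (subst emeasure_Diff_null_set) auto
  also have "\<dots> > 0" using content_ball_pos[of 1 "0::real^'n"] by simp
  finally show ?thesis .
qed

lemma integrable_sphere_measure:
  fixes f :: "real^'n \<Rightarrow> 'b::{banach, second_countable_topology}"
  assumes "f \<in> borel_measurable borel" and "\<And>x. norm x = 1 \<Longrightarrow> norm (f x) \<le> B"
  shows "integrable sphere_measure f"
proof (rule sphere_measure.integrable_const_bound)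
  show "AE x in sphere_measure. norm (f x) \<le> B"
    using AE_sphere_measure by eventually_elim (use assms in auto)
qed (use assms in simp)

lemma integral_sphere_measure_cong:
  fixes f g :: "real^'n \<Rightarrow> 'b::{banach, second_countable_topology}"
  assumes "f \<in> borel_measurable borel" "g \<in> borel_measurable borel"
    and "\<And>x. norm x = 1 \<Longrightarrow> f x = g x"
  shows "(\<integral>x. f x \<partial>sphere_measure) = (\<integral>x. g x \<partial>sphere_measure)"
proof (rule integral_cong_AE)
  show "AE x in sphere_measure. f x = g x"
    using AE_sphere_measure by eventually_elim (use assms in auto)
qed (use assms in auto)

lemma sphere_measure_isometry:
  fixes U :: "real^'n \<Rightarrow> real^'n"
  assumes U: "orthogonal_transformation U"
  shows "distr sphere_measure borel U = sphere_measure"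
proof (rule measure_eqI)
  have linU: "linear U" using U by (rule orthogonal_transformation_linear)
  have U_meas [measurable]: "U \<in> borel_measurable borel"
    by (intro borel_measurable_continuous_onI linear_continuous_on linear_conv_bounded_linear[THEN iffD1] linU)
  have U0: "U x = 0 \<longleftrightarrow> x = 0" for x
    using orthogonal_transformation_norm[OF U, of x] by (metis norm_eq_zero)
  fix A assume "A \<in> sets (distr sphere_measure borel U)"
  then have [measurable]: "A \<in> sets borel" by simp
  define B where "B = ball 0 1 - {0::real^'n}"
  have [measurable]: "B \<in> sets borel" by (simp add: B_def)
  have sph: "emeasure sphere_measure A = emeasure lborel {x\<in>B. x /\<^sub>R norm x \<in> A}"
    if "A \<in> sets borel" for A
    using that unfolding sphere_measure_def B_def
    by (subst emeasure_distr) (auto simp: emeasure_restrict_space space_restrict_space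
        sets_restrict_space intro!: arg_cong2[where f = emeasure])
  have "emeasure (distr sphere_measure borel U) A = emeasure sphere_measure (U -` A)"
    by (subst emeasure_distr) auto
  also have "\<dots> = emeasure lborel {x\<in>B. x /\<^sub>R norm x \<in> U -` A}"
    by (rule sph) (use measurable_sets[OF U_meas, of A] in simp)
  also have "{x\<in>B. x /\<^sub>R norm x \<in> U -` A} = U -` {x\<in>B. x /\<^sub>R norm x \<in> A}"
    by (auto simp: B_def orthogonal_transformation_norm[OF U] linear_scale[OF linU] U0)
  also have "emeasure lborel \<dots> = emeasure (distr lborel borel U) {x\<in>B. x /\<^sub>R norm x \<in> A}"
    by (subst emeasure_distr) auto
  also have "\<dots> = emeasure sphere_measure A"
    by (simp add: lborel_distr_isometry[OF U] sph)
  finally show "emeasure (distr sphere_measure borel U) A = emeasure sphere_measure A" .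
qed simp

lemma sphere_integral_isometry:
  fixes f :: "real^'n \<Rightarrow> 'b::{banach, second_countable_topology}" and U :: "real^'n \<Rightarrow> real^'n"
  assumes U: "orthogonal_transformation U" and f: "f \<in> borel_measurable borel"
  shows "(\<integral>x. f (U x) \<partial>sphere_measure) = (\<integral>x. f x \<partial>sphere_measure)"
proof -
  have [measurable]: "U \<in> borel_measurable borel"
    by (intro borel_measurable_continuous_onI linear_continuous_on
        linear_conv_bounded_linear[THEN iffD1] orthogonal_transformation_linear U)
  have "(\<integral>x. f x \<partial>sphere_measure) = (\<integral>x. f x \<partial>distr sphere_measure borel U)"
    by (simp add: sphere_measure_isometry[OF U])
  also have "\<dots> = (\<integral>x. f (U x) \<partial>sphere_measure)"
    by (rule integral_distr) (use f in auto)
  finally show ?thesis ..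
qed

text \<open>
  Orthogonal transformations act transitively on vectors of equal length.
\<close>

lemma sphere_moment_eq:
  fixes v w :: "real^'n"
  assumes "norm v = norm w"
  shows "(\<integral>x. (x \<bullet> v) ^ N \<partial>sphere_measure) = (\<integral>x. (x \<bullet> w) ^ N \<partial>sphere_measure)"
proof -
  obtain U where U: "orthogonal_transformation U" "U v = w"
    using orthogonal_transformation_exists[OF assms] .
  have "(\<integral>x. (x \<bullet> w) ^ N \<partial>sphere_measure) = (\<integral>x. (U x \<bullet> w) ^ N \<partial>sphere_measure)"
    by (rule sphere_integral_isometry[OF U(1), symmetric]) simp
  also have "(\<lambda>x. U x \<bullet> w) = (\<lambda>x. x \<bullet> v)"
    using U by (metis orthogonal_transformation_def)
  finally show ?thesis by (metis (no_types, lifting) Bochner_Integration.integral_cong)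
qed

lemma sphere_integral_odd:
  fixes f :: "real^'n \<Rightarrow> 'b::{banach, second_countable_topology}"
  assumes [measurable]: "f \<in> borel_measurable borel" and "\<And>x. f (- x) = - f x"
  shows "(\<integral>x. f x \<partial>sphere_measure) = 0"
proof -
  have "(\<integral>x. f x \<partial>sphere_measure) = (\<integral>x. f (- x) \<partial>sphere_measure)"
    by (rule sphere_integral_isometry[symmetric]) (auto simp: orthogonal_transformation_neg)
  also have "\<dots> = - (\<integral>x. f x \<partial>sphere_measure)"
    by (simp add: assms(2))
  finally have "2 *\<^sub>R (\<integral>x. f x \<partial>sphere_measure) = 0"
    by (simp add: scaleR_2 eq_neg_iff_add_eq_0)
  then show ?thesis by simp
qed

section \<open>Moments against powers of an isotropic linear form\<close>

text \<open>
  This is what carries identities between real moments over to complex directions.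
\<close>

lemma poly_eq_if_eq_on_reals:
  fixes p q :: "complex poly"
  assumes "\<And>t::real. poly p (of_real t) = poly q (of_real t)"
  shows "p = q"
proof -
  have "infinite (range complex_of_real)"
    using finite_imageD[of complex_of_real UNIV] infinite_UNIV_char_0[where 'a = real]
    by (auto simp: inj_on_def)
  moreover have "range complex_of_real \<subseteq> {x. poly (p - q) x = 0}"
    using assms by auto
  ultimately have "infinite {x. poly (p - q) x = 0}"
    using finite_subset by blast
  then show ?thesis using poly_roots_finite[of "p - q"] by auto
qed

lemma coeff_sum_monom: "coeff (\<Sum>i\<le>N. monom (f i) i) j = (if j \<le> N then f j else 0)"
  by (simp add: coeff_sum)

text \<open>
  The function \<open>u \<mapsto> \<integral> (A + u B)\<^sup>N\<close> as a formal polynomial, so that moments can be read off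
  as coefficients.
\<close>

definition binomial_moment_poly ::
    "(real^'n \<Rightarrow> complex) \<Rightarrow> (real^'n \<Rightarrow> complex) \<Rightarrow> nat \<Rightarrow> complex poly" where
  "binomial_moment_poly A B N =
     (\<Sum>i\<le>N. monom (of_nat (N choose i) * (\<integral>x. A x ^ (N - i) * B x ^ i \<partial>sphere_measure)) i)"

lemma poly_binomial_moment_poly:
  fixes A B :: "real^'n \<Rightarrow> complex"
  assumes A: "continuous_on UNIV A" and B: "continuous_on UNIV B"
  shows "poly (binomial_moment_poly A B N) u = (\<integral>x. (A x + u * B x) ^ N \<partial>sphere_measure)"
proof -
  have int: "integrable sphere_measure f" if f: "continuous_on UNIV f" for f :: "real^'n \<Rightarrow> complex"
  proof -
    have "compact (f ` sphere 0 1)"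
      by (intro compact_continuous_image continuous_on_subset[OF f]) auto
    then obtain C where "\<And>x. norm x = 1 \<Longrightarrow> norm (f x) \<le> C"
      using compact_imp_bounded[of "f ` sphere 0 1"] unfolding bounded_iff
      by (metis image_eqI mem_sphere_0)
    then show ?thesis
      by (intro integrable_sphere_measure) (use f in \<open>auto intro: borel_measurable_continuous_onI\<close>)
  qed
  have "(A x + u * B x) ^ N = (\<Sum>i\<le>N. (of_nat (N choose i) * u ^ i) * (A x ^ (N - i) * B x ^ i))" for x
    by (subst add.commute, subst binomial_ring) (simp add: power_mult_distrib mult_ac)
  then have "(\<integral>x. (A x + u * B x) ^ N \<partial>sphere_measure) =
      (\<integral>x. (\<Sum>i\<le>N. (of_nat (N choose i) * u ^ i) * (A x ^ (N - i) * B x ^ i)) \<partial>sphere_measure)"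
    by simp
  also have "\<dots> = (\<Sum>i\<le>N. (of_nat (N choose i) * u ^ i) * (\<integral>x. A x ^ (N - i) * B x ^ i \<partial>sphere_measure))"
    by (subst Bochner_Integration.integral_sum)
       (auto intro!: int continuous_intros A B)
  also have "\<dots> = poly (binomial_moment_poly A B N) u"
    by (simp add: binomial_moment_poly_def poly_sum poly_monom mult_ac)
  finally show ?thesis ..
qed

lemma coeff_binomial_moment_poly:
  assumes "j \<le> N"
  shows "coeff (binomial_moment_poly A B N) j =
      of_nat (N choose j) * (\<integral>x. A x ^ (N - j) * B x ^ j \<partial>sphere_measure)"
  using assms by (simp add: binomial_moment_poly_def coeff_sum_monom)

definition moment :: "real^'n \<Rightarrow> nat \<Rightarrow> real" where
  "moment e N = (\<integral>x. (x \<bullet> e) ^ N \<partial>sphere_measure)"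

text \<open>
  By invariance and homogeneity only the length of the direction matters.
\<close>

lemma even_moment:
  fixes v e :: "real^'n"
  assumes "norm e = 1"
  shows "moment v (2 * p) = moment e (2 * p) * (v \<bullet> v) ^ p"
proof -
  have "moment v (2 * p) = (\<integral>x. (x \<bullet> (norm v *\<^sub>R e)) ^ (2 * p) \<partial>sphere_measure)"
    unfolding moment_def by (rule sphere_moment_eq) (simp add: assms)
  also have "\<dots> = (\<integral>x. norm v ^ (2 * p) * (x \<bullet> e) ^ (2 * p) \<partial>sphere_measure)"
    by (simp add: power_mult_distrib)
  also have "norm v ^ (2 * p) = (v \<bullet> v) ^ p"
    by (simp add: power_mult dot_square_norm)
  finally show ?thesis by (simp add: moment_def mult.commute)
qed

text \<open>
  For real \<open>u, w\<close> this is \<open>even_moment\<close> for the vector \<open>y + u a + w b\<close>. Both sides are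
  polynomials in each of \<open>u\<close> and \<open>w\<close>, so the two parameters can be freed one after the other.
\<close>

lemma complexified_even_moment:
  fixes y a b e :: "real^'n" and u w :: complex
  assumes "norm e = 1" and y: "norm y = 1" "norm a = 1" "norm b = 1" "a \<bullet> b = 0"
  shows "(\<integral>x. (of_real (x \<bullet> y) + u * of_real (x \<bullet> a) + w * of_real (x \<bullet> b)) ^ (2 * p) \<partial>sphere_measure) =
    of_real (moment e (2 * p)) *
      (1 + 2 * u * of_real (y \<bullet> a) + 2 * w * of_real (y \<bullet> b) + u\<^sup>2 + w\<^sup>2) ^ p"
    (is "?L u w = ?R u w")
proof -
  have real: "?L (of_real s) (of_real t) = ?R (of_real s) (of_real t)" for s t :: real
  proof -
    define v where "v = y + s *\<^sub>R a + t *\<^sub>R b"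
    have vv: "v \<bullet> v = 1 + 2 * s * (y \<bullet> a) + 2 * t * (y \<bullet> b) + s\<^sup>2 + t\<^sup>2"
      using y by (simp add: v_def inner_simps inner_commute norm_eq_1 power2_eq_square algebra_simps)
    have "?L (of_real s) (of_real t) = (\<integral>x. of_real ((x \<bullet> v) ^ (2 * p)) \<partial>sphere_measure)"
      by (simp add: v_def inner_simps)
    also have "\<dots> = of_real (moment v (2 * p))"
      by (simp only: moment_def integral_complex_of_real)
    finally show ?thesis
      by (simp add: even_moment[OF assms(1), of v] vv)
  qed
  have mixed: "?L u (of_real t) = ?R u (of_real t)" for u :: complex and t :: real
  proof -
    define P where "P = binomial_moment_poly
      (\<lambda>x. of_real (x \<bullet> y) + of_real t * of_real (x \<bullet> b)) (\<lambda>x. of_real (x \<bullet> a)) (2 * p)"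
    define Q :: "complex poly" where "Q = smult (of_real (moment e (2 * p)))
      ([:1 + 2 * of_real t * of_real (y \<bullet> b) + (of_real t)\<^sup>2, 2 * of_real (y \<bullet> a), 1:] ^ p)"
    have P: "poly P u = ?L u (of_real t)" for u :: complex
      unfolding P_def by (subst poly_binomial_moment_poly) (auto intro!: continuous_intros simp: add_ac)
    have Q: "poly Q u = ?R u (of_real t)" for u :: complex
      by (simp add: Q_def power2_eq_square algebra_simps)
    have "P = Q" by (rule poly_eq_if_eq_on_reals) (simp only: P Q real)
    then show ?thesis by (simp only: flip: P Q)
  qed
  define P where "P = binomial_moment_poly
    (\<lambda>x. of_real (x \<bullet> y) + u * of_real (x \<bullet> a)) (\<lambda>x. of_real (x \<bullet> b)) (2 * p)"
  define Q :: "complex poly" where "Q = smult (of_real (moment e (2 * p)))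
    ([:1 + 2 * u * of_real (y \<bullet> a) + u\<^sup>2, 2 * of_real (y \<bullet> b), 1:] ^ p)"
  have P: "poly P w = ?L u w" for w :: complex
    unfolding P_def by (subst poly_binomial_moment_poly) (auto intro!: continuous_intros simp: add_ac)
  have Q: "poly Q w = ?R u w" for w :: complex
    by (simp add: Q_def power2_eq_square algebra_simps)
  have "P = Q" by (rule poly_eq_if_eq_on_reals) (simp only: P Q mixed)
  then show ?thesis by (simp only: flip: P Q)
qed

text \<open>
  The choice \<open>w = i u\<close> removes the term \<open>u\<^sup>2 + w\<^sup>2\<close>. What is left on the right is a power of a
  linear polynomial in \<open>u\<close>, and the coefficients of \<open>u\<^sup>j\<close> are compared.
\<close>

lemma isotropic_moment:
  fixes y a b e :: "real^'n"
  assumes e: "norm e = 1" and y: "norm y = 1" "norm a = 1" "norm b = 1" "a \<bullet> b = 0"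
    and j: "j \<le> 2 * p"
  shows "of_nat ((2 * p) choose j) *
      (\<integral>x. of_real ((x \<bullet> y) ^ (2 * p - j)) * Complex (x \<bullet> a) (x \<bullet> b) ^ j \<partial>sphere_measure) =
    of_real (moment e (2 * p) * (p choose j) * 2 ^ j) * Complex (y \<bullet> a) (y \<bullet> b) ^ j"
proof -
  let ?\<zeta> = "Complex (y \<bullet> a) (y \<bullet> b)"
  define P where "P = binomial_moment_poly
    (\<lambda>x. of_real (x \<bullet> y)) (\<lambda>x. Complex (x \<bullet> a) (x \<bullet> b)) (2 * p)"
  define Q :: "complex poly" where "Q = smult (of_real (moment e (2 * p)))
    (\<Sum>i\<le>p. monom (of_nat (p choose i) * (2 * ?\<zeta>) ^ i) i)"
  have "poly P u = poly Q u" for u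
  proof -
    have "poly P u = (\<integral>x. (of_real (x \<bullet> y) + u * Complex (x \<bullet> a) (x \<bullet> b)) ^ (2 * p) \<partial>sphere_measure)"
      unfolding P_def
      by (subst poly_binomial_moment_poly) (auto intro!: continuous_intros simp: Complex_eq)
    also have "\<dots> = (\<integral>x. (of_real (x \<bullet> y) + u * of_real (x \<bullet> a) + (\<i> * u) * of_real (x \<bullet> b)) ^ (2 * p) \<partial>sphere_measure)"
      by (simp add: Complex_eq algebra_simps)
    also have "\<dots> = of_real (moment e (2 * p)) * (1 + 2 * u * of_real (y \<bullet> a)
        + 2 * (\<i> * u) * of_real (y \<bullet> b) + u\<^sup>2 + (\<i> * u)\<^sup>2) ^ p"
      by (rule complexified_even_moment[OF e y])
    also have "1 + 2 * u * of_real (y \<bullet> a) + 2 * (\<i> * u) * of_real (y \<bullet> b) + u\<^sup>2 + (\<i> * u)\<^sup>2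
        = (2 * ?\<zeta>) * u + 1"
      by (simp add: Complex_eq power_mult_distrib algebra_simps)
    also have "of_real (moment e (2 * p)) * \<dots> ^ p = poly Q u"
      by (subst binomial_ring)
         (simp add: Q_def poly_sum poly_monom power_mult_distrib mult_ac)
    finally show ?thesis .
  qed
  then have "P = Q" by (simp add: poly_eq_poly_eq_iff[symmetric] ext)
  then have "coeff P j = coeff Q j" by simp
  moreover have "coeff Q j = of_real (moment e (2 * p) * (p choose j) * 2 ^ j) * ?\<zeta> ^ j"
    by (auto simp: Q_def coeff_sum_monom power_mult_distrib binomial_eq_0)
  ultimately show ?thesis
    by (simp add: P_def coeff_binomial_moment_poly[OF j])
qed

text \<open>
  For two orthonormal directions the identity \<open>\<integral> (x \<bullet> f + u x \<bullet> g)\<^sup>2\<^sup>p = (1 + u\<^sup>2)\<^sup>p \<integral> (x \<bullet> f)\<^sup>2\<^sup>p\<close>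
  yields the mixed moments at \<open>u\<^sup>2\<close>. Summing over all coordinates \<open>g\<close> other than \<open>f\<close> and using that the
  squares of the coordinates add up to 1 on the sphere closes the recursion.
\<close>

lemma even_moment_rec:
  fixes e :: "real^'n"
  assumes e: "norm e = 1" and p: "p \<ge> 1"
  shows "real (2 * p - 1) * (moment e (2 * p - 2) - moment e (2 * p)) = (real CARD('n) - 1) * moment e (2 * p)"
proof -
  obtain k0 :: 'n where True by simp
  define f where "f = (axis k0 1 :: real^'n)"
  have f: "norm f = 1" "x \<bullet> f = x $ k0" for x
    by (auto simp: f_def inner_axis)
  have mom: "moment e N = moment f N" for N
    unfolding moment_def by (rule sphere_moment_eq) (simp add: e f)
  have off: "(2 * p - 1) * (\<integral>x. (x $ k0) ^ (2 * p - 2) * (x $ k)\<^sup>2 \<partial>sphere_measure) = moment f (2 * p)"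
    if k: "k \<noteq> k0" for k
  proof -
    define g where "g = (axis k 1 :: real^'n)"
    have g: "norm g = 1" "x \<bullet> g = x $ k" for x
      by (auto simp: g_def inner_axis)
    have fg: "f \<bullet> g = 0" using k by (simp add: f_def g_def inner_axis_axis)
    define P where "P = binomial_moment_poly
      (\<lambda>x. of_real (x \<bullet> f)) (\<lambda>x. of_real (x \<bullet> g)) (2 * p)"
    define Q :: "complex poly" where "Q = smult (of_real (moment f (2 * p))) (\<Sum>i\<le>p. monom (of_nat (p choose i)) (2 * i))"
    have "poly P u = poly Q u" for u
    proof -
      have "poly P u = (\<integral>x. (of_real (x \<bullet> f) + u * of_real (x \<bullet> g) + 0 * of_real (x \<bullet> f)) ^ (2 * p) \<partial>sphere_measure)"
        unfolding P_def
        by (subst poly_binomial_moment_poly) (auto intro!: continuous_intros)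
      also have "\<dots> = of_real (moment f (2 * p)) * (u\<^sup>2 + 1) ^ p"
        by (subst complexified_even_moment[OF f(1)]) (use f(1) g(1) fg in \<open>auto simp: inner_commute add_ac\<close>)
      also have "\<dots> = poly Q u"
        by (subst binomial_ring)
          (simp add: Q_def poly_sum poly_monom mult_ac flip: power_mult)
      finally show ?thesis .
    qed
    then have "P = Q" by (simp add: poly_eq_poly_eq_iff[symmetric] ext)
    then have "coeff P 2 = coeff Q 2" by simp
    moreover have "coeff Q 2 = of_real (moment f (2 * p) * p)"
    proof -
      have "coeff (\<Sum>i\<le>p. monom (of_nat (p choose i) :: complex) (2 * i)) 2 =
         (\<Sum>i\<le>p. if i = 1 then of_nat (p choose i) else 0)"
        unfolding coeff_sum by (intro sum.cong) (auto simp: coeff_monom)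
      then show ?thesis using p by (simp add: Q_def)
    qed
    moreover have "coeff P 2 = of_real (real ((2 * p) choose 2) *
        (\<integral>x. (x $ k0) ^ (2 * p - 2) * (x $ k)\<^sup>2 \<partial>sphere_measure))"
    proof -
      have "(\<integral>x. complex_of_real (x $ k0) ^ (2 * p - 2) * complex_of_real (x $ k) ^ 2 \<partial>sphere_measure) =
          of_real (\<integral>x. (x $ k0) ^ (2 * p - 2) * (x $ k)\<^sup>2 \<partial>sphere_measure)"
        by (simp flip: of_real_power of_real_mult)
      then show ?thesis
        unfolding P_def using p by (subst coeff_binomial_moment_poly) (auto simp: f g)
    qed
    ultimately have "complex_of_real (real ((2 * p) choose 2) *
        (\<integral>x. (x $ k0) ^ (2 * p - 2) * (x $ k)\<^sup>2 \<partial>sphere_measure)) = of_real (moment f (2 * p) * p)"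
      by (simp only:)
    then have "real ((2 * p) choose 2) *
        (\<integral>x. (x $ k0) ^ (2 * p - 2) * (x $ k)\<^sup>2 \<partial>sphere_measure) = moment f (2 * p) * p"
      by (simp only: of_real_eq_iff)
    moreover have "real ((2 * p) choose 2) = real p * (2 * p - 1)"
      using p by (simp add: choose_two of_nat_diff)
    ultimately show ?thesis using p by (simp add: of_nat_diff mult_ac)
  qed
  have int: "integrable sphere_measure (\<lambda>x::real^'n. (x $ k0) ^ m * (x $ k)\<^sup>2)" for m k
  proof (rule integrable_sphere_measure[of _ 1])
    fix x :: "real^'n" assume x: "norm x = 1"
    have "\<bar>x $ k\<bar> \<le> 1" "\<bar>x $ k0\<bar> \<le> 1"
      using component_le_norm_cart[of x] x by metis+
    then show "norm ((x $ k0) ^ m * (x $ k)\<^sup>2) \<le> 1"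
      by (simp add: abs_mult power_abs power_le_one mult_le_one abs_square_le_1)
  qed simp
  have "(real CARD('n) - 1) * moment f (2 * p) = (\<Sum>k\<in>UNIV - {k0}. moment f (2 * p))"
    by (simp add: card_Diff_singleton of_nat_diff)
  also have "\<dots> = (\<Sum>k\<in>UNIV - {k0}. (2 * p - 1) * (\<integral>x. (x $ k0) ^ (2 * p - 2) * (x $ k)\<^sup>2 \<partial>sphere_measure))"
    by (intro sum.cong refl off[symmetric]) auto
  also have "\<dots> = (2 * p - 1) * (\<integral>x. (\<Sum>k\<in>UNIV - {k0}. (x $ k0) ^ (2 * p - 2) * (x $ k)\<^sup>2) \<partial>sphere_measure)"
    by (subst Bochner_Integration.integral_sum) (auto simp: int sum_distrib_left)
  also have "(\<integral>x. (\<Sum>k\<in>UNIV - {k0}. (x $ k0) ^ (2 * p - 2) * (x $ k)\<^sup>2) \<partial>sphere_measure)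
      = (\<integral>x. (x $ k0) ^ (2 * p - 2) * (x $ k0)^0 - (x $ k0) ^ (2 * p - 2) * (x $ k0)\<^sup>2 \<partial>sphere_measure)"
  proof (rule integral_sphere_measure_cong)
    fix x :: "real^'n" assume "norm x = 1"
    then have "1 = (\<Sum>k\<in>UNIV. (x $ k)\<^sup>2)"
      by (simp add: norm_eq_1 inner_vec_def power2_eq_square)
    also have "\<dots> = (x $ k0)\<^sup>2 + (\<Sum>k\<in>UNIV - {k0}. (x $ k)\<^sup>2)"
      by (subst sum.remove[of _ k0]) auto
    finally have "(\<Sum>k\<in>UNIV - {k0}. (x $ k)\<^sup>2) = 1 - (x $ k0)\<^sup>2" by simp
    then show "(\<Sum>k\<in>UNIV - {k0}. (x $ k0) ^ (2 * p - 2) * (x $ k)\<^sup>2) =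
       (x $ k0) ^ (2 * p - 2) * (x $ k0)^0 - (x $ k0) ^ (2 * p - 2) * (x $ k0)\<^sup>2"
      by (simp only: sum_distrib_left[symmetric]) (simp add: algebra_simps)
  qed auto
  also have "\<dots> = moment f (2 * p - 2) - moment f (2 * p)"
  proof -
    have "(x $ k0) ^ (2 * p - 2) * (x $ k0)\<^sup>2 = (x $ k0) ^ (2 * p)" for x :: "real^'n"
      using p by (cases p) (auto simp: power2_eq_square)
    moreover have "integrable sphere_measure (\<lambda>x::real^'n. (x $ k0) ^ m)" for m
    proof (rule integrable_sphere_measure[of _ 1])
      fix x :: "real^'n" assume x: "norm x = 1"
      then have "\<bar>x $ k0\<bar> \<le> 1"
        using component_le_norm_cart[of x] by metis
      then show "norm ((x $ k0) ^ m) \<le> 1"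
        by (simp add: power_abs power_le_one)
    qed simp
    ultimately show ?thesis by (simp add: moment_def f)
  qed
  finally show ?thesis by (simp add: mom)
qed

section \<open>The symmetric beta weight\<close>

text \<open>
  Under \<open>t = 1 - 2u\<close> the weight \<open>(u (1 - u)) powr (A - 1)\<close> is a constant multiple of
  \<open>(1 - t\<^sup>2) powr (A - 1)\<close>, the ultraspherical weight on \<open>[-1, 1]\<close>. Working on \<open>[0, 1]\<close> turns
  \<open>1 - t\<close> into \<open>2u\<close>, so that powers of it integrate to values of \<open>Beta\<close>.
\<close>

definition beta_measure :: "real \<Rightarrow> real measure" where
  "beta_measure A = density lborel
     (\<lambda>u. ennreal (indicator {0<..<1} u * (u powr (A - 1) * (1 - u) powr (A - 1))))"

lemma sets_beta_measure [simp, measurable_cong]: "sets (beta_measure A) = sets borel"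
  by (simp add: beta_measure_def)

lemma AE_beta_measure: "AE u in beta_measure A. 0 < u \<and> u < 1"
  unfolding beta_measure_def
  by (subst AE_density) (auto intro!: AE_I2 simp: indicator_def split: if_splits)

lemma beta_measure_powr:
  assumes A: "A > 0" and s: "s \<ge> 0"
  shows "integrable (beta_measure A) (\<lambda>u. u powr s)"
    and "(\<integral>u. u powr s \<partial>beta_measure A) = Beta (s + A) A"
proof -
  let ?w = "\<lambda>u::real. indicator {0<..<1} u * (u powr (A - 1) * (1 - u) powr (A - 1))"
  have "((\<lambda>t. t powr (s + A - 1) * (1 - t) powr (A - 1)) has_integral Beta (s + A) A) {0<..<1}"
    using has_integral_Beta_real[of "s + A" A] A s by (simp add: has_integral_Icc_iff_Ioo)
  then have "((\<lambda>t. indicator {0<..<1} t * (t powr (s + A - 1) * (1 - t) powr (A - 1))) has_integral Beta (s + A) A) UNIV"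
    by (subst (asm) has_integral_restrict_UNIV[symmetric])
      (erule has_integral_eq[rotated], simp add: indicator_def)
  also have "(\<lambda>t::real. indicator {0<..<1} t * (t powr (s + A - 1) * (1 - t) powr (A - 1)))
      = (\<lambda>t. ?w t * t powr s)"
    by (auto simp: indicator_def fun_eq_iff powr_add[symmetric] algebra_simps)
  finally have hi: "((\<lambda>t. ?w t * t powr s) has_integral Beta (s + A) A) UNIV" .
  have nn: "0 \<le> ?w t * t powr s" for t by (simp add: indicator_def)
  have "integrable lborel (\<lambda>t. ?w t * t powr s)"
    and val: "(\<integral>t. ?w t * t powr s \<partial>lborel) = Beta (s + A) A"
    using has_bochner_integral_iff nn_integral_has_integral_lborel[OF _ nn hi] nn
    by (auto intro!: integrableI_nn_integral_finite integral_eq_nn_integral[THEN trans]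
        intro: has_integral_nonneg[OF hi] simp: enn2real_ennreal has_integral_nonneg[OF hi])
  then show "integrable (beta_measure A) (\<lambda>u. u powr s)"
    unfolding beta_measure_def by (subst integrable_density) (auto simp: indicator_def)
  show "(\<integral>u. u powr s \<partial>beta_measure A) = Beta (s + A) A"
    unfolding beta_measure_def using val by (subst integral_density) (auto simp: indicator_def)
qed

lemma finite_beta_measure:
  assumes A: "A > 0"
  shows "finite_measure (beta_measure A)"
proof -
  have "integrable (beta_measure A) (\<lambda>u. u powr 0)"
    using beta_measure_powr(1)[OF A, of 0] by simp
  then have "integrable (beta_measure A) (\<lambda>u. 1::real)"
    by (rule integrable_cong_AE_imp) (use AE_beta_measure[of A] in auto)
  then show ?thesis
    by (intro finite_measureI) (simp add: integrable_iff_bounded less_top)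
qed

lemma integrable_beta_measure:
  fixes f :: "real \<Rightarrow> real"
  assumes A: "A > 0" and [measurable]: "f \<in> borel_measurable borel"
    and "\<And>u. 0 < u \<Longrightarrow> u < 1 \<Longrightarrow> \<bar>f u\<bar> \<le> B"
  shows "integrable (beta_measure A) f"
proof -
  interpret finite_measure "beta_measure A" by (rule finite_beta_measure[OF A])
  show ?thesis
  proof (rule integrable_const_bound)
    show "AE u in beta_measure A. norm (f u) \<le> B"
      using AE_beta_measure by eventually_elim (use assms in auto)
  qed simp
qed

definition beta_moment :: "real \<Rightarrow> nat \<Rightarrow> real" where
  "beta_moment A i = (\<integral>u. (1 - 2 * u) ^ i \<partial>beta_measure A)"

lemma abs_affine_le: "0 < u \<Longrightarrow> u < 1 \<Longrightarrow> \<bar>(1 - 2 * u :: real) ^ i\<bar> \<le> 1"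
  by (simp add: power_abs power_le_one abs_le_iff)

lemma beta_moment_0: "A > 0 \<Longrightarrow> beta_moment A 0 = Beta A A"
proof -
  assume A: "A > 0"
  have "beta_moment A 0 = (\<integral>u. u powr 0 \<partial>beta_measure A)"
    unfolding beta_moment_def
    by (rule integral_cong_AE) (use AE_beta_measure[of A] in auto)
  then show ?thesis using beta_measure_powr(2)[OF A, of 0] by simp
qed

text \<open>
  The derivative of \<open>(1 - 2u)\<^sup>i (u (1 - u)) powr A\<close>, which vanishes at both ends, is integrated, with
  \<open>4u (1 - u) = 1 - (1 - 2u)\<^sup>2\<close>. For \<open>i = 0\<close> this says that the first moment is zero.
\<close>

lemma beta_moment_rec:
  assumes A: "A > 0"
  shows "(A + real i / 2) * beta_moment A (Suc i) = real i / 2 * beta_moment A (i - 1)"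
proof -
  let ?w = "\<lambda>u::real. indicator {0<..<1} u * (u powr (A - 1) * (1 - u) powr (A - 1))"
  define h where "h u = (A + real i / 2) * (1 - 2 * u) ^ Suc i - real i / 2 * (1 - 2 * u) ^ (i - 1)" for u :: real
  have int: "integrable (beta_measure A) (\<lambda>u. c * (1 - 2 * u) ^ k)" for c k
    by (intro integrable_mult_right integrable_beta_measure[OF A, of _ 1] abs_affine_le) auto
  have "integrable (beta_measure A) h"
    unfolding h_def by (intro Bochner_Integration.integrable_diff int)
  moreover have [measurable]: "h \<in> borel_measurable borel"
    unfolding h_def by measurable
  ultimately have "integrable lborel (\<lambda>u. ?w u * h u)"
    unfolding beta_measure_def by (subst (asm) integrable_density) (auto simp: indicator_def)
  then have "((\<lambda>u. ?w u * h u) has_integral (\<integral>u. ?w u * h u \<partial>lborel)) UNIV"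
    by (rule has_integral_integral_lborel)
  also have "(\<integral>u. ?w u * h u \<partial>lborel) = (\<integral>u. h u \<partial>beta_measure A)"
    unfolding beta_measure_def by (subst integral_density) (auto simp: indicator_def)
  finally have 1: "((\<lambda>u. ?w u * h u) has_integral (\<integral>u. h u \<partial>beta_measure A)) UNIV" .
  \<comment> \<open>the boundary values of the antiderivative vanish since \<open>A > 0\<close>\<close>
  define G where "G u = (1 - 2 * u) ^ i * (u powr A * (1 - u) powr A)" for u :: real
  have "((\<lambda>u. ?w u * h u) has_integral (G 1 - G 0)) {0..1}"
  proof (rule fundamental_theorem_of_calculus_interior)
    show "continuous_on {0..1} G"
      unfolding G_def using A by (intro continuous_intros continuous_on_powr') auto
    fix u :: real assume u: "u \<in> {0<..<1}"
    have pw: "u powr A = u powr (A - 1) * u" "(1 - u) powr A = (1 - u) powr (A - 1) * (1 - u)"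
      using u by (auto simp: powr_diff)
    have sp: "real i * (1 - 2 * u) ^ (i - 1) * (1 - 2 * u)\<^sup>2 = real i * (1 - 2 * u) ^ Suc i"
      by (cases i) (auto simp: power2_eq_square)
    have "(G has_real_derivative
        (real i * (1 - 2 * u) ^ (i - 1) * (-2)) * (u powr A * (1 - u) powr A) +
        (1 - 2 * u) ^ i * (A * u powr (A - 1) * (1 - u) powr A + u powr A * (- (A * (1 - u) powr (A - 1))))) (at u)"
      unfolding G_def using u by (auto intro!: derivative_eq_intros simp: algebra_simps)
    also have "(real i * (1 - 2 * u) ^ (i - 1) * (-2)) * (u powr A * (1 - u) powr A) +
        (1 - 2 * u) ^ i * (A * u powr (A - 1) * (1 - u) powr A + u powr A * (- (A * (1 - u) powr (A - 1))))
       = u powr (A - 1) * (1 - u) powr (A - 1) *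
          (A * (1 - 2 * u) ^ Suc i - 1/2 * (real i * (1 - 2 * u) ^ (i - 1)) +
            1/2 * (real i * (1 - 2 * u) ^ (i - 1) * (1 - 2 * u)\<^sup>2))"
      unfolding pw by (simp add: power2_eq_square algebra_simps)
    also have "\<dots> = ?w u * h u"
      unfolding sp h_def using u by (simp add: algebra_simps)
    finally show "(G has_vector_derivative ?w u * h u) (at u)"
      by (simp add: has_real_derivative_iff_has_vector_derivative)
  qed simp
  then have "((\<lambda>u. ?w u * h u) has_integral (G 1 - G 0)) UNIV"
    by (rule has_integral_on_superset) auto
  with 1 have "(\<integral>u. h u \<partial>beta_measure A) = G 1 - G 0"
    by (rule has_integral_unique)
  also have "\<dots> = 0" using A by (simp add: G_def)
  also have "(\<integral>u. h u \<partial>beta_measure A) =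
      (A + real i / 2) * beta_moment A (Suc i) - real i / 2 * beta_moment A (i - 1)"
    unfolding h_def beta_moment_def by (subst Bochner_Integration.integral_diff[OF int int]) simp
  finally show ?thesis by simp
qed

lemma beta_moment_odd:
  assumes "A > 0" "odd i"
  shows "beta_moment A i = 0"
  using assms(2)
proof (induction i rule: less_induct)
  case (less i)
  then obtain k where k: "i = Suc (2 * k)" by (auto elim: oddE)
  have "(A + real (2 * k) / 2) * beta_moment A i = real (2 * k) / 2 * beta_moment A (2 * k - 1)"
    unfolding k by (rule beta_moment_rec[OF assms(1)])
  also have "\<dots> = 0" using less.IH[of "2 * k - 1"] k by (cases k) auto
  finally show ?case using assms(1) by (simp add: add_pos_nonneg less_imp_neq[symmetric])
qed

lemma beta_moment_pos: "A > 0 \<Longrightarrow> beta_moment A 0 > 0"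
  by (simp add: beta_moment_0 Beta_def Gamma_real_pos)

section \<open>The Funk-Hecke formula for monomials\<close>

lemma moment_pos:
  fixes e :: "real^'n"
  assumes e: "norm e = 1"
  shows "moment e (2 * p) > 0"
proof (induction p)
  case 0
  then show ?case using measure_sphere_measure_pos[where 'n = 'n] by (simp add: moment_def)
next
  case (Suc p)
  have "(2 * real p + 1) * (moment e (2 * p) - moment e (2 * Suc p)) = (real CARD('n) - 1) * moment e (2 * Suc p)"
    using even_moment_rec[OF e, of "Suc p"] by (simp add: algebra_simps)
  then have "(2 * real p + 1) * moment e (2 * p) = (2 * real p + real CARD('n)) * moment e (2 * Suc p)"
    by (simp add: algebra_simps)
  moreover have "(2 * real p + 1) * moment e (2 * p) > 0"
    using Suc by (intro mult_pos_pos) auto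
  ultimately show ?case
    by (simp add: zero_less_mult_iff not_less_iff_gr_or_eq)
qed

lemma half_dimension_pos: "CARD('n) \<ge> 2 \<Longrightarrow> real j + (real CARD('n) - 1) / 2 > 0"
  by (intro add_nonneg_pos) auto

text \<open>
  The factor between \<open>\<integral> t\<^sup>n H\<close> and \<open>(n choose j) * beta_moment A (n - j)\<close>, normalised by the case
  \<open>n = j\<close>.
\<close>

definition ultraspherical_const :: "real^'n \<Rightarrow> nat \<Rightarrow> real" where
  "ultraspherical_const e j = moment e (2 * j) * 2 ^ j * (fact j)\<^sup>2 /
     (fact (2 * j) * beta_moment (real j + (real CARD('n) - 1) / 2) 0)"

lemma ultraspherical_const_pos:
  fixes e :: "real^'n"
  assumes "norm e = 1" "CARD('n) \<ge> 2"
  shows "ultraspherical_const e j > 0"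
  unfolding ultraspherical_const_def using assms
  by (intro divide_pos_pos mult_pos_pos moment_pos beta_moment_pos half_dimension_pos) auto

text \<open>
  Both sides satisfy the same first-order recursion in \<open>q\<close>, namely multiplication by
  \<open>(2q + 1) / (2(q + j) + d)\<close>, and they agree at \<open>q = 0\<close>.
\<close>

lemma even_moment_eq_beta_moment:
  fixes e :: "real^'n" and j :: nat
  assumes e: "norm e = 1" and d: "CARD('n) \<ge> 2"
  defines "A \<equiv> real j + (real CARD('n) - 1) / 2"
  shows "moment e (2 * (q + j)) * 2 ^ j * fact (q + j) * fact (2 * q) / (fact q * fact (2 * (q + j)))
    = ultraspherical_const e j / fact j * beta_moment A (2 * q)"
proof (induction q)
  case 0
  have "beta_moment A 0 > 0" by (rule beta_moment_pos) (use half_dimension_pos[OF d] in \<open>simp only: A_def\<close>)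
  then show ?case
    by (simp add: ultraspherical_const_def A_def[symmetric] field_simps power2_eq_square)
next
  case (Suc q)
  define p where "p = q + j"
  define n where "n = real CARD('n)"
  have n2: "n \<ge> 2" using d by (simp add: n_def)
  have A: "A > 0" using half_dimension_pos[OF d] by (simp only: A_def)
  have "(2 * real p + 1) * (moment e (2 * p) - moment e (2 * Suc p)) = (n - 1) * moment e (2 * Suc p)"
    using even_moment_rec[OF e, of "Suc p"] by (simp add: algebra_simps n_def)
  then have m: "moment e (2 * Suc p) = (2 * real p + 1) / (2 * real p + n) * moment e (2 * p)"
    using n2 by (simp add: field_simps)
  have "(A + real (2 * q + 1) / 2) * beta_moment A (2 * Suc q) = real (2 * q + 1) / 2 * beta_moment A (2 * q)"
    using beta_moment_rec[OF A, of "2 * q + 1"] by simp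
  moreover have "A + real (2 * q + 1) / 2 = (2 * real p + n) / 2"
    by (simp add: A_def p_def n_def field_simps)
  ultimately have "(2 * real p + n) / 2 * beta_moment A (2 * Suc q) = real (2 * q + 1) / 2 * beta_moment A (2 * q)"
    by (simp only:)
  then have b: "beta_moment A (2 * Suc q) = (2 * real q + 1) / (2 * real p + n) * beta_moment A (2 * q)"
    using n2 by (simp add: field_simps)
  have f1: "fact (2 * Suc q) = 2 * (real q + 1) * (2 * real q + 1) * fact (2 * q)"
    by (simp add: algebra_simps)
  have f2: "fact (2 * Suc p) = 2 * (real p + 1) * (2 * real p + 1) * fact (2 * p)"
    by (simp add: algebra_simps)
  have f3: "fact (Suc q) = (real q + 1) * fact q" "fact (Suc p) = (real p + 1) * fact p"
    by (simp_all add: algebra_simps)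
  have "moment e (2 * Suc p) * 2 ^ j * fact (Suc p) * fact (2 * Suc q) / (fact (Suc q) * fact (2 * Suc p))
     = (2 * real q + 1) / (2 * real p + n) *
       (moment e (2 * p) * 2 ^ j * fact p * fact (2 * q) / (fact q * fact (2 * p)))"
    unfolding m f1 f2 f3 using n2
    by (simp add: divide_simps add_nonneg_eq_0_iff del: fact_Suc) (simp add: algebra_simps)
  also have "\<dots> = (2 * real q + 1) / (2 * real p + n) * (ultraspherical_const e j / fact j * beta_moment A (2 * q))"
    using Suc.IH by (simp only: p_def)
  also have "\<dots> = ultraspherical_const e j / fact j * beta_moment A (2 * Suc q)"
    unfolding b by (simp add: mult_ac)
  finally show ?case by (simp only: p_def add_Suc)
qed

text \<open>
  Since \<open>fact j * (n choose j) * t ^ (n - j)\<close> is the \<open>j\<close>-th derivative of \<open>t ^ n\<close>, the multiplier of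
  a zonal polynomial \<open>g(t)\<close> is, up to a constant, the integral of the \<open>j\<close>-th derivative of \<open>g\<close> against
  the ultraspherical weight. The binomial coefficient takes care of \<open>n < j\<close>, where both sides vanish.
\<close>

lemma monomial_funk_hecke:
  fixes e y a b :: "real^'n" and j :: nat
  assumes e: "norm e = 1" and y: "norm y = 1" "norm a = 1" "norm b = 1" "a \<bullet> b = 0"
    and d: "CARD('n) \<ge> 2"
  defines "A \<equiv> real j + (real CARD('n) - 1) / 2"
  shows "(\<integral>x. of_real ((x \<bullet> y) ^ n) * Complex (x \<bullet> a) (x \<bullet> b) ^ j \<partial>sphere_measure) =
    of_real (ultraspherical_const e j * (n choose j) * beta_moment A (n - j)) * Complex (y \<bullet> a) (y \<bullet> b) ^ j"
    (is "?E = _")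
proof (cases "even (n + j)")
  case False
  have "Complex (- u) (- v) = - Complex u v" for u v by (simp add: complex_eq_iff)
  moreover have "(-1 :: complex) ^ n * (-1) ^ j = - 1"
    using False by (simp flip: power_add)
  ultimately have "of_real ((- x \<bullet> y) ^ n) * Complex (- x \<bullet> a) (- x \<bullet> b) ^ j =
      - (of_real ((x \<bullet> y) ^ n) * Complex (x \<bullet> a) (x \<bullet> b) ^ j)" for x
    using power_minus[of "x \<bullet> y" n] power_minus[of "Complex (x \<bullet> a) (x \<bullet> b)" j]
    by (simp add: mult.assoc[symmetric] mult.commute mult.left_commute)
  then have "?E = 0"
    by (intro sphere_integral_odd)
      (auto simp: Complex_eq intro!: borel_measurable_continuous_onI continuous_intros)
  moreover have "(n choose j) = 0 \<or> beta_moment A (n - j) = 0"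
    using False half_dimension_pos[OF d, of j]
    by (cases "n < j") (auto simp: binomial_eq_0 A_def intro!: beta_moment_odd)
  ultimately show ?thesis by auto
next
  case True
  then obtain p where p: "n + j = 2 * p" by (metis evenE)
  then have n: "2 * p - j = n" and jp: "j \<le> 2 * p" by auto
  have E: "of_nat ((2 * p) choose j) * ?E =
    of_real (moment e (2 * p) * (p choose j) * 2 ^ j) * Complex (y \<bullet> a) (y \<bullet> b) ^ j"
    using isotropic_moment[OF e y jp] by (simp only: n)
  have nz: "real ((2 * p) choose j) \<noteq> 0" using jp by simp
  have R: "real ((2 * p) choose j) * (ultraspherical_const e j * (n choose j) * beta_moment A (n - j))
    = moment e (2 * p) * (p choose j) * 2 ^ j"
  proof (cases "n < j")
    case True
    then show ?thesis using p by (simp add: binomial_eq_0)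
  next
    case False
    define q where "q = p - j"
    have q: "p = q + j" "n = 2 * q + j" using False p by (auto simp: q_def)
    have c2p: "real ((2 * p) choose j) = fact (2 * p) / (fact j * fact n)"
      using jp n by (simp add: binomial_fact)
    have cn: "real (n choose j) = fact n / (fact j * fact (2 * q))"
      using q by (simp add: binomial_fact)
    have cp: "real (p choose j) = fact p / (fact j * fact q)"
      using q by (simp add: binomial_fact)
    have ub: "ultraspherical_const e j * beta_moment A (2 * q) =
      fact j * (moment e (2 * p) * 2 ^ j * fact p * fact (2 * q) / (fact q * fact (2 * p)))"
      using even_moment_eq_beta_moment[OF e d, where q = q and j = j, folded A_def q(1)] by simp
    have nj: "n - j = 2 * q" using q by simp
    have "real ((2 * p) choose j) * (ultraspherical_const e j * (n choose j) * beta_moment A (n - j))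
      = real ((2 * p) choose j) * real (n choose j) * (ultraspherical_const e j * beta_moment A (2 * q))"
      by (simp add: nj mult_ac)
    also have "\<dots> = moment e (2 * p) * 2 ^ j * real (p choose j)"
      unfolding c2p cn ub cp by (simp add: divide_simps)
    finally show ?thesis by (simp add: mult_ac)
  qed
  have "of_nat ((2 * p) choose j) * ?E = of_real (real ((2 * p) choose j)) *
    (of_real (ultraspherical_const e j * (n choose j) * beta_moment A (n - j)) * Complex (y \<bullet> a) (y \<bullet> b) ^ j)"
    unfolding E R[symmetric] by simp
  then show ?thesis using nz by simp
qed

section \<open>The Funk-Hecke formula for real powers\<close>

text \<open>
  Dilation by \<open>r < 1\<close> keeps the argument strictly inside the disc of convergence, so the binomial
  series may be integrated termwise. The lemma serves both the sphere and the beta weight.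
\<close>

lemma binomial_series_integral:
  fixes t :: "'a \<Rightarrow> real" and h :: "'a \<Rightarrow> complex"
  assumes M: "finite_measure M" and [measurable]: "t \<in> borel_measurable M" "h \<in> borel_measurable M"
    and bd: "AE x in M. \<bar>t x\<bar> \<le> 1 \<and> norm (h x) \<le> C" and r: "0 \<le> r" "r < 1"
  shows "(\<lambda>n. of_real ((s gchoose n) * (- r) ^ n) * (\<integral>x. of_real (t x ^ n) * h x \<partial>M)) sums
    (\<integral>x. of_real ((1 - r * t x) powr s) * h x \<partial>M)"
proof -
  interpret finite_measure M by (rule M)
  define D where "D = max C 0"
  define a where "a n = \<bar>s gchoose n\<bar> * r ^ n" for n
  define f where "f n x = complex_of_real ((s gchoose n) * (- r * t x) ^ n) * h x" for n x
  have [measurable]: "f n \<in> borel_measurable M" for n unfolding f_def by measurable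
  have "summable (\<lambda>n. (s gchoose n) * ((1 + r) / 2) ^ n)"
    using gen_binomial_real[of "(1 + r) / 2" s] r by (auto simp: sums_iff)
  then have "summable (\<lambda>n. norm ((s gchoose n) * r ^ n))"
    by (rule powser_insidea) (use r in auto)
  then have suma: "summable a"
    using r by (simp add: a_def[abs_def] abs_mult)
  have a0: "a n \<ge> 0" for n using r by (simp add: a_def)
  have fb: "norm (f n x) \<le> a n * D" if "\<bar>t x\<bar> \<le> 1" "norm (h x) \<le> C" for n x
  proof -
    have "norm (f n x) = a n * (\<bar>t x\<bar> ^ n * norm (h x))"
      using r by (simp add: f_def a_def norm_mult abs_mult power_abs power_mult_distrib norm_power)
    also have "\<dots> \<le> a n * (1 * D)"
      using that a0 by (intro mult_left_mono mult_mono power_le_one) (auto simp: D_def)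
    finally show ?thesis by simp
  qed
  have int: "integrable M (f n)" for n
    by (rule integrable_const_bound[where B = "a n * D"]) (use bd fb in auto)
  have "(\<lambda>n. \<integral>x. f n x \<partial>M) sums (\<integral>x. (\<Sum>n. f n x) \<partial>M)"
  proof (rule sums_integral[OF int])
    show "AE x in M. summable (\<lambda>n. norm (f n x))"
      using bd
    proof eventually_elim
      case (elim x)
      show ?case
        by (rule summable_comparison_test'[OF summable_mult2[OF suma, of D]])
           (use fb elim in auto)
    qed
    show "summable (\<lambda>n. \<integral>x. norm (f n x) \<partial>M)"
    proof (rule summable_comparison_test'[OF summable_mult2[OF suma, of "D * measure M (space M)"]])
      fix n
      have "(\<integral>x. norm (f n x) \<partial>M) \<le> (\<integral>x. a n * D \<partial>M)"
        by (rule integral_mono_AE) (use int fb bd in auto)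
      then show "norm (\<integral>x. norm (f n x) \<partial>M) \<le> a n * (D * measure M (space M))"
        by (simp add: mult_ac)
    qed
  qed
  also have "(\<integral>x. (\<Sum>n. f n x) \<partial>M) = (\<integral>x. of_real ((1 - r * t x) powr s) * h x \<partial>M)"
  proof (rule integral_cong_AE)
    show "AE x in M. (\<Sum>n. f n x) = of_real ((1 - r * t x) powr s) * h x"
      using bd
    proof eventually_elim
      case (elim x)
      have "r * \<bar>t x\<bar> \<le> r * 1" using elim r by (intro mult_left_mono) auto
      then have "\<bar>- r * t x\<bar> < 1"
        using r by (simp add: abs_mult)
      from gen_binomial_real[OF this, of s]
      have "(\<lambda>n. f n x) sums (of_real ((1 + - r * t x) powr s) * h x)"
        unfolding f_def by (intro sums_mult2 sums_of_real)
      then show ?case by (simp add: sums_iff)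
    qed
  qed measurable
  also have "(\<lambda>n. \<integral>x. f n x \<partial>M) =
      (\<lambda>n. of_real ((s gchoose n) * (- r) ^ n) * (\<integral>x. of_real (t x ^ n) * h x \<partial>M))"
  proof
    fix n
    have "f n x = of_real ((s gchoose n) * (- r) ^ n) * (of_real (t x ^ n) * h x)" for x
      unfolding f_def power_mult_distrib by simp
    then show "(\<integral>x. f n x \<partial>M) = of_real ((s gchoose n) * (- r) ^ n) * (\<integral>x. of_real (t x ^ n) * h x \<partial>M)"
      by simp
  qed
  finally show ?thesis .
qed

lemma norm_Complex_inner_le:
  fixes x a b :: "real^'n"
  assumes "norm x = 1" "norm a = 1" "norm b = 1"
  shows "norm (Complex (x \<bullet> a) (x \<bullet> b) ^ j) \<le> 2 ^ j"
proof -
  have "norm (Complex (x \<bullet> a) (x \<bullet> b)) \<le> \<bar>x \<bullet> a\<bar> + \<bar>x \<bullet> b\<bar>"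
    using cmod_le[of "Complex (x \<bullet> a) (x \<bullet> b)"] by simp
  also have "\<dots> \<le> 2"
    using Cauchy_Schwarz_ineq2[of x a] Cauchy_Schwarz_ineq2[of x b] assms by simp
  finally show ?thesis by (simp add: norm_power power_mono)
qed

lemma abs_inner_le_1: "norm x = 1 \<Longrightarrow> norm y = 1 \<Longrightarrow> \<bar>x \<bullet> y\<bar> \<le> 1"
  using Cauchy_Schwarz_ineq2[of x y] by simp

lemma measurable_Complex_inner [measurable]:
  "(\<lambda>x::real^'n. Complex (x \<bullet> a) (x \<bullet> b)) \<in> borel_measurable borel"
  by (auto simp: Complex_eq intro!: borel_measurable_continuous_onI continuous_intros)

text \<open>
  Both integrals are expanded into binomial series. They match term by term since
  \<open>(s choose (n + j)) ((n + j) choose j) = (s choose j) ((s - j) choose n)\<close>.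
\<close>

lemma dilated_powr_funk_hecke:
  fixes e y a b :: "real^'n" and j :: nat and s r :: real
  assumes e: "norm e = 1" and y: "norm y = 1" "norm a = 1" "norm b = 1" "a \<bullet> b = 0"
    and d: "CARD('n) \<ge> 2" and r: "0 \<le> r" "r < 1"
  defines "A \<equiv> real j + (real CARD('n) - 1) / 2"
  shows "(\<integral>x. of_real ((1 - r * (x \<bullet> y)) powr s) * Complex (x \<bullet> a) (x \<bullet> b) ^ j \<partial>sphere_measure) =
    of_real (ultraspherical_const e j * (s gchoose j) * (- r) ^ j *
      (\<integral>u. (1 - r * (1 - 2 * u)) powr (s - j) \<partial>beta_measure A)) * Complex (y \<bullet> a) (y \<bullet> b) ^ j"
    (is "?L = ?R")
proof -
  let ?\<zeta> = "Complex (y \<bullet> a) (y \<bullet> b)"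
  have A: "A > 0" using half_dimension_pos[OF d] by (simp only: A_def)
  define T where "T n = of_real ((s gchoose n) * (- r) ^ n) *
    (of_real (ultraspherical_const e j * (n choose j) * beta_moment A (n - j)) * ?\<zeta> ^ j)" for n
  have "(\<lambda>n. of_real ((s gchoose n) * (- r) ^ n) *
      (\<integral>x. of_real ((x \<bullet> y) ^ n) * Complex (x \<bullet> a) (x \<bullet> b) ^ j \<partial>sphere_measure)) sums ?L"
  proof (rule binomial_series_integral[OF finite_sphere_measure _ _ _ r])
    show "AE x in sphere_measure. \<bar>x \<bullet> y\<bar> \<le> 1 \<and> norm (Complex (x \<bullet> a) (x \<bullet> b) ^ j) \<le> 2 ^ j"
      using AE_sphere_measure
      by eventually_elim (use y norm_Complex_inner_le abs_inner_le_1 in auto)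
  qed auto
  then have 1: "T sums ?L"
    unfolding T_def A_def by (simp only: monomial_funk_hecke[OF e y d])
  have "(\<lambda>n. of_real ((s - j gchoose n) * (- r) ^ n) * (\<integral>u. complex_of_real ((1 - 2 * u) ^ n) * 1 \<partial>beta_measure A)) sums
    (\<integral>u. of_real ((1 - r * (1 - 2 * u)) powr (s - j)) * 1 \<partial>beta_measure A)"
  proof (rule binomial_series_integral[OF finite_beta_measure[OF A] _ _ _ r])
    show "AE u in beta_measure A. \<bar>1 - 2 * u\<bar> \<le> 1 \<and> norm (1::complex) \<le> 1"
      using AE_beta_measure[of A] by eventually_elim auto
  qed auto
  then have "(\<lambda>n. complex_of_real ((s - j gchoose n) * (- r) ^ n) * of_real (beta_moment A n)) sums
    of_real (\<integral>u. (1 - r * (1 - 2 * u)) powr (s - j) \<partial>beta_measure A)"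
    unfolding beta_moment_def mult_1_right integral_complex_of_real .
  then have "(\<lambda>n. of_real (ultraspherical_const e j * (s gchoose j) * (- r) ^ j) * ?\<zeta> ^ j *
      (of_real ((s - j gchoose n) * (- r) ^ n) * of_real (beta_moment A n))) sums
    (of_real (ultraspherical_const e j * (s gchoose j) * (- r) ^ j) * ?\<zeta> ^ j *
      of_real (\<integral>u. (1 - r * (1 - 2 * u)) powr (s - j) \<partial>beta_measure A))"
    by (rule sums_mult)
  also have "of_real (ultraspherical_const e j * (s gchoose j) * (- r) ^ j) * ?\<zeta> ^ j *
      of_real (\<integral>u. (1 - r * (1 - 2 * u)) powr (s - j) \<partial>beta_measure A) = ?R"
    by (simp add: mult_ac)
  also have "(\<lambda>n. of_real (ultraspherical_const e j * (s gchoose j) * (- r) ^ j) * ?\<zeta> ^ j *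
      (of_real ((s - j gchoose n) * (- r) ^ n) * of_real (beta_moment A n))) = (\<lambda>n. T (n + j))"
  proof
    fix n
    have "(s gchoose (n + j)) * real ((n + j) choose j) = (s gchoose j) * (s - j gchoose n)"
      using gbinomial_trinomial_revision[of j "n + j" s] by (simp add: binomial_gbinomial)
    moreover have "T (n + j) = of_real (((s gchoose (n + j)) * real ((n + j) choose j)) *
        ((- r) ^ (n + j) * ultraspherical_const e j * beta_moment A n)) * ?\<zeta> ^ j"
      unfolding T_def by (simp add: mult_ac)
    ultimately have "T (n + j) = of_real (((s gchoose j) * (s - j gchoose n)) *
        ((- r) ^ (n + j) * ultraspherical_const e j * beta_moment A n)) * ?\<zeta> ^ j"
      by (simp only:)
    then show "of_real (ultraspherical_const e j * (s gchoose j) * (- r) ^ j) * ?\<zeta> ^ j *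
      (of_real ((s - j gchoose n) * (- r) ^ n) * of_real (beta_moment A n)) = T (n + j)"
      by (simp add: power_add mult_ac)
  qed
  finally have "T sums ?R"
    by (subst (asm) sums_zero_iff_shift) (auto simp: T_def binomial_eq_0)
  with 1 show ?thesis by (rule sums_unique2)
qed

text \<open>
  The limit \<open>r \<rightarrow> 1\<close> of the dilated formula. The restriction \<open>s \<ge> j\<close> makes the integrand on the
  beta side bounded, so constants dominate on both sides.
\<close>

lemma powr_funk_hecke:
  fixes e y a b :: "real^'n" and j :: nat and s :: real
  assumes e: "norm e = 1" and y: "norm y = 1" "norm a = 1" "norm b = 1" "a \<bullet> b = 0"
    and d: "CARD('n) \<ge> 2" and s: "s > 0" "s \<ge> j"
  defines "A \<equiv> real j + (real CARD('n) - 1) / 2"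
  shows "(\<integral>x. of_real ((1 - x \<bullet> y) powr s) * Complex (x \<bullet> a) (x \<bullet> b) ^ j \<partial>sphere_measure) =
    of_real (ultraspherical_const e j * (s gchoose j) * (- 1) ^ j *
      (2 powr (s - j) * Beta (s - j + A) A)) * Complex (y \<bullet> a) (y \<bullet> b) ^ j"
proof -
  let ?\<zeta> = "Complex (y \<bullet> a) (y \<bullet> b)"
  have A: "A > 0" using half_dimension_pos[OF d] by (simp only: A_def)
  interpret b: finite_measure "beta_measure A" by (rule finite_beta_measure[OF A])
  define r where "r m = 1 - inverse (real (Suc (m + 1)))" for m :: nat
  have r: "0 \<le> r m" "r m < 1" for m by (auto simp: r_def field_simps)
  have rlim: "r \<longlonglongrightarrow> 1" unfolding r_def
    using tendsto_diff[OF tendsto_const LIMSEQ_ignore_initial_segment[OF LIMSEQ_inverse_real_of_nat, of 1], of 1]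
    by simp
  have base: "0 \<le> 1 - r m * t" "1 - r m * t \<le> 2" if "\<bar>t\<bar> \<le> 1" for t :: real and m
  proof -
    have "\<bar>r m * t\<bar> \<le> 1" using r[of m] that by (auto simp: abs_mult intro!: mult_le_one)
    then show "0 \<le> 1 - r m * t" "1 - r m * t \<le> 2" by (auto simp: abs_le_iff)
  qed
  have 1: "(\<lambda>m. \<integral>x. of_real ((1 - r m * (x \<bullet> y)) powr s) * Complex (x \<bullet> a) (x \<bullet> b) ^ j \<partial>sphere_measure)
    \<longlonglongrightarrow> (\<integral>x. of_real ((1 - 1 * (x \<bullet> y)) powr s) * Complex (x \<bullet> a) (x \<bullet> b) ^ j \<partial>sphere_measure)"
  proof (rule integral_dominated_convergence[where w = "\<lambda>_. 2 powr s * 2 ^ j"])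
    show "AE x in sphere_measure. (\<lambda>m. of_real ((1 - r m * (x \<bullet> y)) powr s) * Complex (x \<bullet> a) (x \<bullet> b) ^ j)
        \<longlonglongrightarrow> of_real ((1 - 1 * (x \<bullet> y)) powr s) * Complex (x \<bullet> a) (x \<bullet> b) ^ j"
      using AE_sphere_measure
    proof eventually_elim
      case (elim x)
      then have "\<bar>x \<bullet> y\<bar> \<le> 1" using y by (auto intro: abs_inner_le_1)
      then have "(\<lambda>m. (1 - r m * (x \<bullet> y)) powr s) \<longlonglongrightarrow> (1 - 1 * (x \<bullet> y)) powr s"
        by (intro tendsto_powr' tendsto_intros rlim) (use s base in auto)
      then show ?case by (intro tendsto_mult tendsto_of_real tendsto_const)
    qed
    show "AE x in sphere_measure. norm (of_real ((1 - r m * (x \<bullet> y)) powr s) * Complex (x \<bullet> a) (x \<bullet> b) ^ j)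
        \<le> 2 powr s * 2 ^ j" for m
      using AE_sphere_measure
    proof eventually_elim
      case (elim x)
      then have "\<bar>x \<bullet> y\<bar> \<le> 1" using y by (auto intro: abs_inner_le_1)
      then have "(1 - r m * (x \<bullet> y)) powr s \<le> 2 powr s"
        by (intro powr_mono2 base) (use s in auto)
      moreover have "norm (Complex (x \<bullet> a) (x \<bullet> b) ^ j) \<le> 2 ^ j"
        using elim y by (intro norm_Complex_inner_le) auto
      ultimately show ?case
        unfolding norm_mult by (intro mult_mono) auto
    qed
  qed auto
  have "(\<lambda>m. \<integral>u. (1 - r m * (1 - 2 * u)) powr (s - j) \<partial>beta_measure A)
    \<longlonglongrightarrow> (\<integral>u. 2 powr (s - j) * u powr (s - j) \<partial>beta_measure A)"
  proof (rule integral_dominated_convergence[where w = "\<lambda>_. 2 powr (s - j)"])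
    show "AE u in beta_measure A. (\<lambda>m. (1 - r m * (1 - 2 * u)) powr (s - j))
        \<longlonglongrightarrow> 2 powr (s - j) * u powr (s - j)"
      using AE_beta_measure[of A]
    proof eventually_elim
      case (elim u)
      have "(\<lambda>m. (1 - r m * (1 - 2 * u)) powr (s - j)) \<longlonglongrightarrow> (1 - 1 * (1 - 2 * u)) powr (s - j)"
        by (intro tendsto_powr tendsto_intros rlim) (use elim in auto)
      then show ?case using elim by (simp add: powr_mult)
    qed
    show "AE u in beta_measure A. norm ((1 - r m * (1 - 2 * u)) powr (s - j)) \<le> 2 powr (s - j)" for m
      using AE_beta_measure[of A]
    proof eventually_elim
      case (elim u)
      have "(1 - r m * (1 - 2 * u)) powr (s - j) \<le> 2 powr (s - j)"
        by (intro powr_mono2 base) (use elim s in auto)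
      then show ?case by simp
    qed
  qed auto
  also have "(\<integral>u. 2 powr (s - j) * u powr (s - j) \<partial>beta_measure A) = 2 powr (s - j) * Beta (s - j + A) A"
    using beta_measure_powr(2)[OF A, of "s - j"] s by simp
  finally have "(\<lambda>m. of_real (ultraspherical_const e j * (s gchoose j) * (- r m) ^ j *
      (\<integral>u. (1 - r m * (1 - 2 * u)) powr (s - j) \<partial>beta_measure A)) * ?\<zeta> ^ j)
    \<longlonglongrightarrow> of_real (ultraspherical_const e j * (s gchoose j) * (- 1) ^ j *
      (2 powr (s - j) * Beta (s - j + A) A)) * ?\<zeta> ^ j"
    by (intro tendsto_intros rlim)
  then have "(\<lambda>m. \<integral>x. of_real ((1 - r m * (x \<bullet> y)) powr s) * Complex (x \<bullet> a) (x \<bullet> b) ^ j \<partial>sphere_measure)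
    \<longlonglongrightarrow> of_real (ultraspherical_const e j * (s gchoose j) * (- 1) ^ j *
      (2 powr (s - j) * Beta (s - j + A) A)) * ?\<zeta> ^ j"
    unfolding A_def by (simp only: dilated_powr_funk_hecke[OF e y d r])
  with 1 show ?thesis
    by (auto dest: LIMSEQ_unique)
qed

section \<open>The logarithmic kernel\<close>

text \<open>
  On \<open>s \<ge> \<beta>\<close> the multiplier is a constant times the exponential of a sum of \<open>ln_Gamma\<close> terms, and
  differentiating these produces the four \<open>Digamma\<close> values of \<open>tau\<close>. A one-sided derivative is stated
  because \<open>powr_funk_hecke\<close> covers only \<open>s \<ge> j\<close>, and \<open>\<beta> = j\<close> is possible.
\<close>

lemma eigenvalue_derivative:
  fixes lam A :: real and \<Phi> :: "real \<Rightarrow> real" and j \<beta> :: nat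
  assumes lam: "lam \<ge> 0" and j: "j \<le> \<beta>"
  defines "A \<equiv> real j + lam + 1 / 2"
  defines "\<Phi> \<equiv> \<lambda>s::real. (s gchoose j) * (2 powr (s - j) * Beta (s - j + A) A)"
  shows "(\<Phi> has_real_derivative \<Phi> \<beta> * (tau \<beta> j lam - ln 2)) (at \<beta> within {\<beta>..})"
proof -
  define C where "C = Gamma A / (fact j * 2 powr j)"
  define \<Lambda> where "\<Lambda> s = s * ln 2 + ln_Gamma (s + 1) + ln_Gamma (s + lam + 1 / 2)
    - ln_Gamma (s - j + 1) - ln_Gamma (s + j + 2 * lam + 1)" for s :: real
  have eq: "\<Phi> s = C * exp (\<Lambda> s)" if s: "s \<ge> \<beta>" for s :: real
  proof -
    have s0: "s \<ge> j" "s \<ge> 0" using s j by auto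
    have "s + 1 \<notin> \<int>\<^sub>\<le>\<^sub>0" using s0 by (auto dest: nonpos_Ints_nonpos)
    then have "(s gchoose j) = Gamma (s + 1) / (fact j * Gamma (s - j + 1))"
      by (rule gbinomial_Gamma)
    moreover have "2 powr (s - j) = exp (s * ln 2) / 2 powr j"
      by (simp add: powr_def left_diff_distrib exp_diff)
    moreover have "Beta (s - j + A) A = Gamma (s + lam + 1 / 2) * Gamma A / Gamma (s + j + 2 * lam + 1)"
    proof -
      have eqs: "s - j + A = s + lam + 1 / 2" "s + lam + 1 / 2 + A = s + j + 2 * lam + 1"
        by (simp_all add: A_def)
      show ?thesis unfolding Beta_def eqs ..
    qed
    moreover have "exp (\<Lambda> s) = exp (s * ln 2) * Gamma (s + 1) * Gamma (s + lam + 1 / 2)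
      / (Gamma (s - j + 1) * Gamma (s + j + 2 * lam + 1))"
      using s0 lam by (simp add: \<Lambda>_def exp_diff exp_add Gamma_real_pos_exp)
    ultimately show ?thesis by (simp add: \<Phi>_def C_def mult_ac)
  qed
  have "(\<Lambda> has_real_derivative (tau \<beta> j lam - ln 2)) (at \<beta>)"
  proof -
    have "ln 4 = 2 * ln (2::real)" using ln_realpow[of 2 2] by simp
    then have tau: "tau \<beta> j lam - ln 2 = ln 2 + Digamma (real \<beta> + 1) + Digamma (real \<beta> + lam + 1 / 2)
        - Digamma (real \<beta> - j + 1) - Digamma (real \<beta> + j + 2 * lam + 1)"
      by (simp add: tau_def)
    have shift: "((\<lambda>s. ln_Gamma (s + c)) has_real_derivative Digamma (real \<beta> + c)) (at (real \<beta>))"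
      if "real \<beta> + c > 0" for c
      using has_field_derivative_ln_Gamma_real[OF that] by (simp only: DERIV_shift)
    have "((\<lambda>s. s * ln 2 + ln_Gamma (s + 1) + ln_Gamma (s + (lam + 1 / 2))
        - ln_Gamma (s + (1 - real j)) - ln_Gamma (s + (real j + 2 * lam + 1))) has_real_derivative
      ln 2 + Digamma (real \<beta> + 1) + Digamma (real \<beta> + (lam + 1 / 2))
        - Digamma (real \<beta> + (1 - real j)) - Digamma (real \<beta> + (real j + 2 * lam + 1))) (at (real \<beta>))"
      by (intro DERIV_add DERIV_diff shift) (use lam j in \<open>auto intro!: derivative_eq_intros\<close>)
    then show ?thesis
      unfolding \<Lambda>_def tau by (simp add: algebra_simps)
  qed
  then have "((\<lambda>s. C * exp (\<Lambda> s)) has_real_derivative C * (exp (\<Lambda> \<beta>) * (tau \<beta> j lam - ln 2))) (at \<beta>)"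
    by (intro DERIV_cmult DERIV_chain2[OF DERIV_exp])
  then have "((\<lambda>s. C * exp (\<Lambda> s)) has_real_derivative (C * exp (\<Lambda> \<beta>)) * (tau \<beta> j lam - ln 2)) (at \<beta> within {\<beta>..})"
    unfolding mult.assoc by (rule has_field_derivative_at_within)
  moreover have "C * exp (\<Lambda> \<beta>) = \<Phi> \<beta>" by (simp add: eq)
  ultimately have "((\<lambda>s. C * exp (\<Lambda> s)) has_real_derivative \<Phi> \<beta> * (tau \<beta> j lam - ln 2)) (at \<beta> within {\<beta>..})"
    by (simp only:)
  then show ?thesis
    by (rule has_field_derivative_transform_within[where d = 1]) (auto simp: eq)
qed

text \<open>
  The factor \<open>v\<close> split off from \<open>v powr \<beta>\<close> absorbs the singularity of \<open>ln v\<close> at 0. This uniform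
  bound is the dominating constant for differentiating under the integral sign.
\<close>

lemma powr_difference_quotient_bound:
  fixes v h :: real and \<beta> :: nat
  assumes v: "0 \<le> v" "v \<le> 2" and h: "0 < h" "h \<le> 1" and \<beta>: "\<beta> \<ge> 1"
  shows "\<bar>(v powr (\<beta> + h) - v powr \<beta>) / h\<bar> \<le> 2 ^ (\<beta> + 1)"
proof (cases "v = 0")
  case False
  then have v0: "v > 0" using v by simp
  obtain b where b: "\<beta> = Suc b" using \<beta> by (cases \<beta>) auto
  have pos: "\<bar>v powr h - 1\<bar> * v \<le> 4 * h"
  proof (cases "v \<le> 1")
    case True
    have "1 + h * ln v \<le> v powr h"
      using exp_ge_add_one_self[of "h * ln v"] v0 by (simp add: powr_def)
    moreover have "v powr h \<le> 1" using True v0 h by (simp add: powr_le1)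
    ultimately have "\<bar>v powr h - 1\<bar> \<le> h * (- ln v)" by simp
    also have "- ln v \<le> 1 / v - 1"
      using ln_le_minus_one[of "1 / v"] v0 by (simp add: ln_div)
    finally have "\<bar>v powr h - 1\<bar> * v \<le> h * (1 / v - 1) * v"
      using h v0 by (simp add: mult_right_mono)
    also have "\<dots> = h * (1 - v)" using v0 by (simp add: field_simps)
    also have "\<dots> \<le> 4 * h" using h v0 by (simp add: algebra_simps)
    finally show ?thesis .
  next
    case False
    have "1 - h * ln v \<le> v powr (- h)"
      using exp_ge_add_one_self[of "- h * ln v"] v0 by (simp add: powr_def)
    then have "(1 - h * ln v) * v powr h \<le> v powr (- h) * v powr h"
      by (rule mult_right_mono) simp
    also have "\<dots> = 1" using v0 by (simp flip: powr_add)
    finally have "v powr h - 1 \<le> h * ln v * v powr h" by (simp add: algebra_simps)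
    moreover have "v powr h \<ge> 1" using False h by (simp add: ge_one_powr_ge_zero)
    ultimately have "\<bar>v powr h - 1\<bar> \<le> h * (ln v * v powr h)" by simp
    also have "ln v * v powr h \<le> 1 * 2"
    proof (rule mult_mono)
      show "ln v \<le> 1" using ln_le_minus_one[OF v0] v by simp
      have "v powr h \<le> v powr 1" using False h by (intro powr_mono) auto
      then show "v powr h \<le> 2" using v by simp
    qed auto
    finally have "\<bar>v powr h - 1\<bar> * v \<le> h * 2 * 2"
      using h v v0 by (intro mult_mono) auto
    then show ?thesis by simp
  qed
  have "v powr (\<beta> + h) - v powr \<beta> = (v powr h - 1) * v * v ^ b"
    using v0 by (simp add: powr_add powr_realpow b algebra_simps)
  then have "\<bar>v powr (\<beta> + h) - v powr \<beta>\<bar> = (\<bar>v powr h - 1\<bar> * v) * v ^ b"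
    using v0 by (simp add: abs_mult)
  also have "\<dots> \<le> (4 * h) * 2 ^ b"
    using pos v v0 h by (intro mult_mono[OF pos] power_mono) auto
  finally show ?thesis using h by (simp add: b field_simps)
qed (use \<beta> in simp)

lemma powr_difference_quotient_tendsto:
  fixes v :: real and h :: "nat \<Rightarrow> real"
  assumes v: "v \<ge> 0" and h: "\<And>m. h m > 0" "h \<longlonglongrightarrow> 0" and \<beta>: "\<beta> \<ge> 1"
  shows "(\<lambda>m. (v powr (real \<beta> + h m) - v powr \<beta>) / h m) \<longlonglongrightarrow> v ^ \<beta> * ln v"
proof (cases "v = 0")
  case False
  then have v0: "v > 0" using v by simp
  have "((\<lambda>s. v powr s) has_real_derivative v powr \<beta> * ln v) (at (real \<beta>))"
    using v0 by (auto intro!: derivative_eq_intros)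
  then have "((\<lambda>k::real. (v powr (\<beta> + k) - v powr \<beta>) / k) \<longlongrightarrow> v powr \<beta> * ln v) (at 0)"
    by (simp add: DERIV_def)
  moreover have "filterlim h (at 0) sequentially"
    unfolding filterlim_at using h by (auto simp: less_imp_neq[symmetric])
  ultimately have "(\<lambda>m. (v powr (real \<beta> + h m) - v powr \<beta>) / h m) \<longlonglongrightarrow> v powr \<beta> * ln v"
    by (rule filterlim_compose)
  then show ?thesis using v0 by (simp add: powr_realpow)
qed (use \<beta> in simp)

lemma abs_power_mult_ln_le:
  fixes v :: real
  assumes v: "0 \<le> v" "v \<le> 2" and \<beta>: "\<beta> \<ge> 1"
  shows "\<bar>v ^ \<beta> * ln v\<bar> \<le> 2 ^ (\<beta> + 1)"
proof -
  define h where "h m = inverse (real (Suc m))" for m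
  have h: "0 < h m" "h m \<le> 1" for m by (auto simp: h_def field_simps)
  have "h \<longlonglongrightarrow> 0" unfolding h_def by (rule LIMSEQ_inverse_real_of_nat)
  then have "(\<lambda>m. (v powr (real \<beta> + h m) - v powr \<beta>) / h m) \<longlonglongrightarrow> v ^ \<beta> * ln v"
    by (intro powr_difference_quotient_tendsto v h \<beta>)
  then have "(\<lambda>m. \<bar>(v powr (real \<beta> + h m) - v powr \<beta>) / h m\<bar>) \<longlonglongrightarrow> \<bar>v ^ \<beta> * ln v\<bar>"
    by (rule tendsto_rabs)
  then show ?thesis
    by (rule LIMSEQ_le_const2) (use powr_difference_quotient_bound[OF v h \<beta>] in blast)
qed

text \<open>
  Differentiating \<open>powr_funk_hecke\<close> in \<open>s\<close> at \<open>\<beta>\<close> brings a factor \<open>ln (1 - t)\<close> under the integral and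
  multiplies the value by \<open>\<tau> - ln 2\<close>. Subtracting that multiple of the undifferentiated formula gives zero.
\<close>

lemma log_kernel_annihilated:
  fixes y a b :: "real^'n" and j \<beta> :: nat
  assumes y: "norm y = 1" "norm a = 1" "norm b = 1" "a \<bullet> b = 0"
    and d: "CARD('n) \<ge> 2" and \<beta>: "\<beta> \<ge> 1" "j \<le> \<beta>"
  shows "(\<integral>x. of_real ((1 - x \<bullet> y) ^ \<beta> * (ln 2 - tau \<beta> j ((real CARD('n) - 2) / 2) + ln (1 - x \<bullet> y)))
      * Complex (x \<bullet> a) (x \<bullet> b) ^ j \<partial>sphere_measure) = 0"
proof -
  define lam where "lam = (real CARD('n) - 2) / 2"
  have lam: "lam \<ge> 0" using d by (simp add: lam_def)
  define A where "A = real j + lam + 1 / 2"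
  have A: "A = real j + (real CARD('n) - 1) / 2" by (simp add: A_def lam_def field_simps)
  define \<Phi> where "\<Phi> = (\<lambda>s::real. (s gchoose j) * (2 powr (s - j) * Beta (s - j + A) A))"
  define \<zeta> where "\<zeta> = Complex (y \<bullet> a) (y \<bullet> b)"
  define K where "K = ultraspherical_const y j * (- 1) ^ j"
  define H where "H x = Complex (x \<bullet> a) (x \<bullet> b) ^ j" for x
  define \<tau> where "\<tau> = tau \<beta> j lam - ln 2"
  have [measurable]: "H \<in> borel_measurable borel" unfolding H_def by measurable
  have Hb: "norm (H x) \<le> 2 ^ j" if "norm x = 1" for x
    unfolding H_def using that y by (intro norm_Complex_inner_le)
  have F: "(\<integral>x. of_real ((1 - x \<bullet> y) powr s) * H x \<partial>sphere_measure) = of_real (K * \<Phi> s) * \<zeta> ^ j"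
    if "s \<ge> \<beta>" for s :: real
    using powr_funk_hecke[OF y(1) y d, of s j] that \<beta>
    by (simp add: H_def \<zeta>_def K_def \<Phi>_def A mult_ac)
  define h where "h m = inverse (real (Suc m))" for m
  have h: "0 < h m" "h m \<le> 1" for m by (auto simp: h_def field_simps)
  have hlim: "h \<longlonglongrightarrow> 0" unfolding h_def by (rule LIMSEQ_inverse_real_of_nat)
  have int: "integrable sphere_measure (\<lambda>x. of_real ((1 - x \<bullet> y) powr s) * H x)" if "s \<ge> 0" for s
  proof (rule integrable_sphere_measure[of _ "2 powr s * 2 ^ j"])
    fix x :: "real^'n" assume x: "norm x = 1"
    have "\<bar>x \<bullet> y\<bar> \<le> 1" using x y by (intro abs_inner_le_1)
    then have "(1 - x \<bullet> y) powr s \<le> 2 powr s"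
      using that by (intro powr_mono2) (auto simp: abs_le_iff)
    then show "norm (of_real ((1 - x \<bullet> y) powr s) * H x) \<le> 2 powr s * 2 ^ j"
      unfolding norm_mult by (intro mult_mono Hb x) auto
  qed measurable
  have L: "(\<lambda>m. \<integral>x. of_real (((1 - x \<bullet> y) powr (\<beta> + h m) - (1 - x \<bullet> y) powr \<beta>) / h m) * H x \<partial>sphere_measure)
    \<longlonglongrightarrow> (\<integral>x. of_real ((1 - x \<bullet> y) ^ \<beta> * ln (1 - x \<bullet> y)) * H x \<partial>sphere_measure)"
  proof (rule integral_dominated_convergence[where w = "\<lambda>_. 2 ^ (\<beta> + 1) * 2 ^ j"])
    show "AE x in sphere_measure. (\<lambda>m. of_real (((1 - x \<bullet> y) powr (\<beta> + h m) - (1 - x \<bullet> y) powr \<beta>) / h m) * H x)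
      \<longlonglongrightarrow> of_real ((1 - x \<bullet> y) ^ \<beta> * ln (1 - x \<bullet> y)) * H x"
      using AE_sphere_measure
    proof eventually_elim
      case (elim x)
      then have x: "x \<bullet> y \<le> 1" using abs_inner_le_1[of x y] y by (simp add: abs_le_iff)
      have "(\<lambda>m. ((1 - x \<bullet> y) powr (\<beta> + h m) - (1 - x \<bullet> y) powr \<beta>) / h m)
        \<longlonglongrightarrow> (1 - x \<bullet> y) ^ \<beta> * ln (1 - x \<bullet> y)"
        using x h hlim \<beta> by (intro powr_difference_quotient_tendsto) auto
      then show ?case by (intro tendsto_mult tendsto_of_real tendsto_const)
    qed
    show "AE x in sphere_measure. norm (of_real (((1 - x \<bullet> y) powr (\<beta> + h m) - (1 - x \<bullet> y) powr \<beta>) / h m) * H x)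
      \<le> 2 ^ (\<beta> + 1) * 2 ^ j" for m
      using AE_sphere_measure
    proof eventually_elim
      case (elim x)
      then have x: "\<bar>x \<bullet> y\<bar> \<le> 1" using y by (intro abs_inner_le_1)
      have "\<bar>((1 - x \<bullet> y) powr (\<beta> + h m) - (1 - x \<bullet> y) powr \<beta>) / h m\<bar> \<le> 2 ^ (\<beta> + 1)"
        using x h \<beta> by (intro powr_difference_quotient_bound) (auto simp: abs_le_iff)
      then show ?case
        unfolding norm_mult norm_of_real by (intro mult_mono Hb elim) auto
    qed
  qed auto
  have "(\<lambda>m. (\<Phi> (\<beta> + h m) - \<Phi> \<beta>) / h m) \<longlonglongrightarrow> \<Phi> \<beta> * \<tau>"
  proof -
    have "((\<lambda>s. (\<Phi> s - \<Phi> \<beta>) / (s - \<beta>)) \<longlongrightarrow> \<Phi> \<beta> * \<tau>) (at \<beta> within {real \<beta>..})"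
      using eigenvalue_derivative[OF lam \<beta>(2)]
      unfolding has_field_derivative_iff \<Phi>_def A_def \<tau>_def .
    moreover have "filterlim (\<lambda>m. \<beta> + h m) (at \<beta> within {real \<beta>..}) sequentially"
      unfolding filterlim_at using tendsto_add[OF tendsto_const hlim, of "real \<beta>"] h
      by (auto simp: less_imp_neq[symmetric] less_imp_le)
    ultimately show ?thesis
      by (auto dest: filterlim_compose)
  qed
  then have "(\<lambda>m. of_real (K * ((\<Phi> (\<beta> + h m) - \<Phi> \<beta>) / h m)) * \<zeta> ^ j) \<longlonglongrightarrow> of_real (K * (\<Phi> \<beta> * \<tau>)) * \<zeta> ^ j"
    by (intro tendsto_mult tendsto_of_real tendsto_const)
  also have "(\<lambda>m. of_real (K * ((\<Phi> (\<beta> + h m) - \<Phi> \<beta>) / h m)) * \<zeta> ^ j) =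
    (\<lambda>m. \<integral>x. of_real (((1 - x \<bullet> y) powr (\<beta> + h m) - (1 - x \<bullet> y) powr \<beta>) / h m) * H x \<partial>sphere_measure)"
  proof
    fix m
    have "(\<integral>x. of_real (((1 - x \<bullet> y) powr (\<beta> + h m) - (1 - x \<bullet> y) powr \<beta>) / h m) * H x \<partial>sphere_measure)
      = (\<integral>x. (of_real ((1 - x \<bullet> y) powr (\<beta> + h m)) * H x - of_real ((1 - x \<bullet> y) powr \<beta>) * H x) / of_real (h m) \<partial>sphere_measure)"
      by (simp add: diff_divide_distrib left_diff_distrib)
    also have "\<dots> = (of_real (K * \<Phi> (\<beta> + h m)) * \<zeta> ^ j - of_real (K * \<Phi> \<beta>) * \<zeta> ^ j) / of_real (h m)"
      using h[of m] by (subst integral_divide_zero, subst Bochner_Integration.integral_diff) (simp_all add: int F)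
    also have "\<dots> = of_real (K * ((\<Phi> (\<beta> + h m) - \<Phi> \<beta>) / h m)) * \<zeta> ^ j"
      by (simp add: diff_divide_distrib algebra_simps)
    finally show "of_real (K * ((\<Phi> (\<beta> + h m) - \<Phi> \<beta>) / h m)) * \<zeta> ^ j =
      (\<integral>x. of_real (((1 - x \<bullet> y) powr (\<beta> + h m) - (1 - x \<bullet> y) powr \<beta>) / h m) * H x \<partial>sphere_measure)" ..
  qed
  finally have log: "(\<integral>x. of_real ((1 - x \<bullet> y) ^ \<beta> * ln (1 - x \<bullet> y)) * H x \<partial>sphere_measure)
      = of_real (K * (\<Phi> \<beta> * \<tau>)) * \<zeta> ^ j"
    using L by (rule LIMSEQ_unique[symmetric])
  have pw: "(\<integral>x. of_real ((1 - x \<bullet> y) ^ \<beta>) * H x \<partial>sphere_measure) = of_real (K * \<Phi> \<beta>) * \<zeta> ^ j"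
  proof -
    have "(\<integral>x. of_real ((1 - x \<bullet> y) ^ \<beta>) * H x \<partial>sphere_measure)
       = (\<integral>x. of_real ((1 - x \<bullet> y) powr \<beta>) * H x \<partial>sphere_measure)"
    proof (rule integral_sphere_measure_cong)
      fix x :: "real^'n" assume "norm x = 1"
      then have "x \<bullet> y \<le> 1" using abs_inner_le_1[of x y] y by (simp add: abs_le_iff)
      then show "of_real ((1 - x \<bullet> y) ^ \<beta>) * H x = of_real ((1 - x \<bullet> y) powr \<beta>) * H x"
        using \<beta> by (cases "x \<bullet> y = 1") (auto simp: powr_realpow zero_power)
    qed auto
    then show ?thesis using F[of \<beta>] by simp
  qed
  have i1: "integrable sphere_measure (\<lambda>x. of_real ((1 - x \<bullet> y) ^ \<beta> * ln (1 - x \<bullet> y)) * H x)"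
  proof (rule integrable_sphere_measure[of _ "2 ^ (\<beta> + 1) * 2 ^ j"])
    fix x :: "real^'n" assume x: "norm x = 1"
    have "\<bar>x \<bullet> y\<bar> \<le> 1" using x y by (intro abs_inner_le_1)
    then have "\<bar>(1 - x \<bullet> y) ^ \<beta> * ln (1 - x \<bullet> y)\<bar> \<le> 2 ^ (\<beta> + 1)"
      by (intro abs_power_mult_ln_le \<beta>) (auto simp: abs_le_iff)
    then show "norm (of_real ((1 - x \<bullet> y) ^ \<beta> * ln (1 - x \<bullet> y)) * H x) \<le> 2 ^ (\<beta> + 1) * 2 ^ j"
      unfolding norm_mult norm_of_real by (intro mult_mono Hb x) auto
  qed measurable
  have i2: "integrable sphere_measure (\<lambda>x. of_real ((1 - x \<bullet> y) ^ \<beta>) * H x)"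
  proof (rule integrable_sphere_measure[of _ "2 ^ \<beta> * 2 ^ j"])
    fix x :: "real^'n" assume x: "norm x = 1"
    have "\<bar>x \<bullet> y\<bar> \<le> 1" using x y by (intro abs_inner_le_1)
    then have "\<bar>(1 - x \<bullet> y) ^ \<beta>\<bar> \<le> 2 ^ \<beta>"
      unfolding power_abs by (intro power_mono) (auto simp: abs_le_iff)
    then show "norm (of_real ((1 - x \<bullet> y) ^ \<beta>) * H x) \<le> 2 ^ \<beta> * 2 ^ j"
      unfolding norm_mult norm_of_real by (intro mult_mono Hb x) auto
  qed measurable
  have "(\<integral>x. of_real ((1 - x \<bullet> y) ^ \<beta> * (- \<tau> + ln (1 - x \<bullet> y))) * H x \<partial>sphere_measure)
    = (\<integral>x. of_real ((1 - x \<bullet> y) ^ \<beta> * ln (1 - x \<bullet> y)) * H x - of_real \<tau> * (of_real ((1 - x \<bullet> y) ^ \<beta>) * H x) \<partial>sphere_measure)"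
    by (rule Bochner_Integration.integral_cong) (simp_all add: algebra_simps)
  also have "\<dots> = of_real (K * (\<Phi> \<beta> * \<tau>)) * \<zeta> ^ j - of_real \<tau> * (of_real (K * \<Phi> \<beta>) * \<zeta> ^ j)"
    by (subst Bochner_Integration.integral_diff) (use i1 i2 in \<open>auto simp: log pw simp del: of_real_mult of_real_power\<close>)
  also have "\<dots> = 0" by simp
  finally show ?thesis by (simp add: \<tau>_def lam_def H_def)
qed

section \<open>Failure of density\<close>

text \<open>
  The functional \<open>g \<mapsto> \<integral> g(T x) h(x)\<close> is bounded for the uniform norm on \<open>S\<close>. If it kills \<open>A\<close>, it
  kills the span, so it cannot be nonzero at a limit of elements of the span.
\<close>

lemma not_fundamental_if_annihilated:
  fixes T :: "'b \<Rightarrow> 'a::topological_space" and h :: "'b \<Rightarrow> complex"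
  assumes M: "finite_measure M" and [measurable]: "T \<in> measurable M borel" "h \<in> borel_measurable M"
    and TS: "AE x in M. T x \<in> S" and hC: "AE x in M. norm (h x) \<le> C"
    and A: "\<And>g. g \<in> A \<Longrightarrow> g \<in> borel_measurable borel" "\<And>g. g \<in> A \<Longrightarrow> bounded (g ` S)"
      "\<And>g. g \<in> A \<Longrightarrow> (\<integral>x. of_real (g (T x)) * h x \<partial>M) = 0"
    and f: "f \<in> X" "f \<in> borel_measurable borel" "bounded (f ` S)"
      "(\<integral>x. of_real (f (T x)) * h x \<partial>M) \<noteq> 0"
  shows "\<not> fundamental_in X (uniform_norm S) A"
proof
  interpret finite_measure M by (rule M)
  assume fund: "fundamental_in X (uniform_norm S) A"
  let ?I = "\<lambda>g. \<integral>x. of_real (g (T x)) * h x \<partial>M"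
  define D where "D = max C 0"
  have D: "D \<ge> 0" "AE x in M. norm (h x) \<le> D"
    using hC by (auto simp: D_def)
  have int: "integrable M (\<lambda>x. of_real (g (T x)) * h x)"
    if [measurable]: "g \<in> borel_measurable borel" and b: "bounded (g ` S)" for g
  proof -
    obtain B where B: "\<And>x. x \<in> S \<Longrightarrow> \<bar>g x\<bar> \<le> B"
      using b by (auto simp: bounded_iff)
    show ?thesis
    proof (rule integrable_const_bound)
      show "AE x in M. norm (of_real (g (T x)) * h x) \<le> B * D"
        using TS D(2)
      proof eventually_elim
        case (elim x)
        have "\<bar>g (T x)\<bar> \<le> B" using B elim by blast
        then show ?case unfolding norm_mult norm_of_real
          using elim by (intro mult_mono) auto
      qed
    qed measurable
  qed
  define m where "m = measure M (space M)"
  have m: "m \<ge> 0" by (simp add: m_def)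
  \<comment> \<open>small enough that the bound \<open>\<epsilon> * D * m\<close> of the functional on the remainder is below its value at \<open>f\<close>\<close>
  define \<epsilon> where "\<epsilon> = norm (?I f) / (D * m + 1)"
  have Dm: "D * m + 1 > 0" using D m by (simp add: add_nonneg_pos)
  then have "\<epsilon> > 0" using f(4) by (simp add: \<epsilon>_def)
  from fund[unfolded fundamental_in_def, rule_format, OF f(1) this]
  obtain Y c where Y: "finite Y" "Y \<subseteq> A" and
    N: "uniform_norm S (\<lambda>x. f x - (\<Sum>g\<in>Y. c g * g x)) < \<epsilon>"
    by (elim exE conjE)
  define r where "r x = f x - (\<Sum>g\<in>Y. c g * g x)" for x
  have Ym: "g \<in> borel_measurable borel" "bounded (g ` S)" "?I g = 0" if "g \<in> Y" for g
    using A that Y(2) by (simp_all add: subset_iff)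
  have "\<forall>g\<in>Y. \<exists>B. \<forall>x\<in>S. \<bar>g x\<bar> \<le> B"
    using Ym(2) by (auto simp: bounded_iff)
  from bchoice[OF this] obtain B where B: "\<And>g x. g \<in> Y \<Longrightarrow> x \<in> S \<Longrightarrow> \<bar>g x\<bar> \<le> B g"
    by blast
  obtain B0 where B0: "\<And>x. x \<in> S \<Longrightarrow> \<bar>f x\<bar> \<le> B0"
    using f(3) by (auto simp: bounded_iff)
  have "\<bar>r x\<bar> \<le> B0 + (\<Sum>g\<in>Y. \<bar>c g\<bar> * B g)" if "x \<in> S" for x
  proof -
    have "\<bar>r x\<bar> \<le> \<bar>f x\<bar> + \<bar>\<Sum>g\<in>Y. c g * g x\<bar>" unfolding r_def by (rule abs_triangle_ineq4)
    also have "\<bar>\<Sum>g\<in>Y. c g * g x\<bar> \<le> (\<Sum>g\<in>Y. \<bar>c g * g x\<bar>)" by (rule sum_abs)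
    also have "\<dots> \<le> (\<Sum>g\<in>Y. \<bar>c g\<bar> * B g)"
      unfolding abs_mult using B that by (intro sum_mono mult_left_mono) auto
    finally show ?thesis using B0[OF that] by linarith
  qed
  then have "bdd_above ((\<lambda>x. \<bar>r x\<bar>) ` S)"
    by (auto simp: bdd_above_def)
  then have r_le: "\<bar>r x\<bar> \<le> \<epsilon>" if "x \<in> S" for x
    using cSUP_upper[OF that] N unfolding uniform_norm_def r_def[symmetric]
    by (meson less_eq_real_def order_trans)
  have intY: "integrable M (\<lambda>x. of_real (c g) * (of_real (g (T x)) * h x))" if "g \<in> Y" for g
    by (intro integrable_mult_right int Ym that)
  have rI: "(\<lambda>x. of_real (r (T x)) * h x) =
    (\<lambda>x. of_real (f (T x)) * h x - (\<Sum>g\<in>Y. of_real (c g) * (of_real (g (T x)) * h x)))"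
    by (simp add: r_def fun_eq_iff algebra_simps sum_distrib_left)
  have ir: "integrable M (\<lambda>x. of_real (r (T x)) * h x)"
    unfolding rI by (intro Bochner_Integration.integrable_diff int f Bochner_Integration.integrable_sum intY)
  have "?I r = ?I f - (\<Sum>g\<in>Y. of_real (c g) * ?I g)"
    unfolding rI by (subst Bochner_Integration.integral_diff)
      (auto intro!: int f Bochner_Integration.integrable_sum intY simp: Bochner_Integration.integral_sum intY)
  also have "\<dots> = ?I f" using Ym(3) by simp
  finally have "norm (?I f) = norm (?I r)" by simp
  also have "\<dots> \<le> (\<integral>x. norm (of_real (r (T x)) * h x) \<partial>M)"
    by (rule integral_norm_bound)
  also have "\<dots> \<le> (\<integral>x. \<epsilon> * D \<partial>M)"
  proof (rule integral_mono_AE)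
    show "integrable M (\<lambda>x. norm (of_real (r (T x)) * h x))"
      by (rule integrable_norm[OF ir])
    show "AE x in M. norm (of_real (r (T x)) * h x) \<le> \<epsilon> * D"
      using TS D(2)
      by eventually_elim (use r_le \<open>\<epsilon> > 0\<close> in \<open>auto simp: norm_mult intro!: mult_mono\<close>)
  qed simp
  also have "\<dots> = \<epsilon> * (D * m)" by (simp add: m_def mult_ac)
  also have "\<dots> < \<epsilon> * (D * m + 1)" using \<open>\<epsilon> > 0\<close> by simp
  also have "\<dots> = norm (?I f)" using Dm by (simp add: \<epsilon>_def)
  finally show False by simp
qed

lemma polyharmonic_spline_on_sphere:
  fixes x y :: "real^'n"
  assumes "norm x = 1" "norm y = 1" and \<rho>: "\<rho> > 0" and k: "2 * k - int d = 2 * int \<beta>" and \<beta>: "\<beta> \<ge> 1"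
  shows "polyharmonic_spline d k (norm (\<rho> *\<^sub>R x - \<rho> *\<^sub>R y)) =
    (2 * \<rho>\<^sup>2) ^ \<beta> / 2 * ((1 - x \<bullet> y) ^ \<beta> * (2 * ln \<rho> + ln 2 + ln (1 - x \<bullet> y)))"
proof -
  define v where "v = 1 - x \<bullet> y"
  define r where "r = norm (\<rho> *\<^sub>R x - \<rho> *\<^sub>R y)"
  have "r\<^sup>2 = \<rho>\<^sup>2 * ((x - y) \<bullet> (x - y))"
    using \<rho> by (simp add: r_def power_mult_distrib dot_square_norm flip: scaleR_right_diff_distrib)
  also have "(x - y) \<bullet> (x - y) = 2 * v"
    using assms by (simp add: v_def inner_simps norm_eq_1 inner_commute)
  finally have r2: "r\<^sup>2 = (2 * \<rho>\<^sup>2) * v" by simp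
  have "r \<ge> 0" by (simp add: r_def)
  show ?thesis
  proof (cases "r = 0")
    case True
    then have "v = 0" using r2 \<rho> by simp
    then show ?thesis using \<beta> True by (simp add: polyharmonic_spline_def v_def flip: r_def)
  next
    case False
    then have r0: "r > 0" using \<open>r \<ge> 0\<close> by simp
    then have "0 < (2 * \<rho>\<^sup>2) * v" unfolding r2[symmetric] by simp
    then have v0: "v > 0" using \<rho> by (simp add: zero_less_mult_iff)
    have "2 * ln r = ln (r\<^sup>2)" using r0 by (simp add: ln_realpow)
    also have "\<dots> = 2 * ln \<rho> + ln 2 + ln v"
      unfolding r2 using \<rho> v0 by (simp add: ln_mult ln_realpow)
    finally have ln: "ln r = (2 * ln \<rho> + ln 2 + ln v) / 2" by simp
    have "r powi (2 * k - int d) = (r\<^sup>2) ^ \<beta>"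
      unfolding k by (simp add: power_int_def nat_mult_distrib power_mult)
    also have "\<dots> = (2 * \<rho>\<^sup>2) ^ \<beta> * v ^ \<beta>" unfolding r2 by (rule power_mult_distrib)
    finally show ?thesis
      using r0 by (simp add: polyharmonic_spline_def ln v_def flip: r_def)
  qed
qed

theorem mainTheorem5:
  fixes d :: nat and k :: int and lam \<rho> :: real and S :: "(real ^ 'n) set"
  assumes "CARD('n) = d" and "d \<ge> 2" and "even d"
    and "of_int k > real d / 2"
    and "lam = (real d - 2) / 2"
    and "\<rho> > 0"
    and "\<exists>j::int. 0 \<le> j \<and> of_int j \<le> of_int k - real d / 2 \<and>
           ln \<rho> = - (1 / 2) * tau (of_int k - real d / 2) j lam"
    and "S = sphere 0 \<rho>"
  shows "\<not> fundamental_in (cont_functions S) (uniform_norm S)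
             (radial_translates S (polyharmonic_spline d k))"
proof -
  have d: "CARD('n) \<ge> 2" using assms by simp
  have \<rho>: "\<rho> > 0" by fact
  obtain p where p: "d = 2 * p" using \<open>even d\<close> by (elim evenE)
  define \<beta> where "\<beta> = nat (k - int p)"
  have "k > int p" using assms(4) p by simp
  then have \<beta>: "\<beta> \<ge> 1" and k: "2 * k - int d = 2 * int \<beta>" and k': "of_int k - real d / 2 = real \<beta>"
    using p by (auto simp: \<beta>_def)
  obtain j :: nat where j: "j \<le> \<beta>" and ln\<rho>: "ln \<rho> = - (1 / 2) * tau \<beta> j lam"
    using assms(7) unfolding k' by (metis nonneg_int_cases of_int_of_nat_eq of_nat_le_iff)
  obtain k0 :: 'n where True by simp
  obtain k1 :: 'n where k1: "k1 \<noteq> k0"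
  proof -
    have "card (UNIV - {k0}) > 0" using d by simp
    then show ?thesis using that by (metis Diff_iff card_gt_0_iff ex_in_conv singletonI)
  qed
  define a b where "a = (axis k0 1 :: real^'n)" and "b = (axis k1 1 :: real^'n)"
  have ab: "norm a = 1" "norm b = 1" "a \<bullet> b = 0"
    using k1 by (auto simp: a_def b_def inner_axis_axis)
  define h where "h x = Complex (x \<bullet> a) (x \<bullet> b) ^ j" for x
  have [measurable]: "h \<in> borel_measurable borel" unfolding h_def by measurable
  have S: "S = sphere 0 \<rho>" by fact
  have [measurable]: "S \<in> sets borel" unfolding S by (intro borel_closed closed_sphere)
  let ?\<phi> = "polyharmonic_spline d k"
  have trans: "\<exists>y. norm y = 1 \<and> g = zero_ext S (\<lambda>x. ?\<phi> (norm (x - \<rho> *\<^sub>R y)))"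
    if g: "g \<in> radial_translates S ?\<phi>" for g
  proof -
    obtain y where y: "y \<in> S" "g = zero_ext S (\<lambda>x. ?\<phi> (norm (x - y)))"
      using g unfolding radial_translates_def by blast
    then show ?thesis
      using \<rho> by (intro exI[of _ "y /\<^sub>R \<rho>"]) (auto simp: S)
  qed
  have on_S: "zero_ext S (\<lambda>x. ?\<phi> (norm (x - \<rho> *\<^sub>R y))) (\<rho> *\<^sub>R x) =
    (2 * \<rho>\<^sup>2) ^ \<beta> / 2 * ((1 - x \<bullet> y) ^ \<beta> * (ln 2 - tau \<beta> j lam + ln (1 - x \<bullet> y)))"
    if "norm x = 1" "norm y = 1" for x y :: "real^'n"
    using polyharmonic_spline_on_sphere[OF that \<rho> k \<beta>] that \<rho> by (simp add: zero_ext_def S ln\<rho>)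
  show ?thesis
  proof (rule not_fundamental_if_annihilated[where M = sphere_measure and T = "\<lambda>x. \<rho> *\<^sub>R x"
        and h = h and C = "2 ^ j" and f = "zero_ext S (\<lambda>x. ((x /\<^sub>R \<rho>) \<bullet> a) ^ j)"])
    show "finite_measure (sphere_measure :: (real^'n) measure)" by (rule finite_sphere_measure)
    show "AE x in sphere_measure. \<rho> *\<^sub>R (x :: real^'n) \<in> S"
      using AE_sphere_measure by eventually_elim (use \<rho> in \<open>simp add: S\<close>)
    show "AE x in sphere_measure. norm (h x) \<le> 2 ^ j"
      using AE_sphere_measure by eventually_elim (use ab norm_Complex_inner_le in \<open>auto simp: h_def\<close>)
  next
    fix g assume "g \<in> radial_translates S ?\<phi>"
    then obtain y where y: "norm y = 1" and g: "g = zero_ext S (\<lambda>x. ?\<phi> (norm (x - \<rho> *\<^sub>R y)))"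
      using trans by blast
    have \<phi>: "?\<phi> r = (if r = 0 then 0 else r ^ (2 * \<beta>) * ln r)" for r
      unfolding polyharmonic_spline_def k by (simp add: power_int_def nat_mult_distrib)
    show meas: "g \<in> borel_measurable borel"
      unfolding g zero_ext_def \<phi> by measurable
    show "bounded (g ` S)"
      unfolding bounded_iff
    proof (intro exI ballI)
      fix z assume "z \<in> g ` S"
      then obtain x where x: "x \<in> S" "z = g x" by blast
      define x' where "x' = x /\<^sub>R \<rho>"
      have x': "norm x' = 1" "x = \<rho> *\<^sub>R x'" using x \<rho> by (auto simp: x'_def S)
      define v where "v = 1 - x' \<bullet> y"
      have v: "0 \<le> v" "v \<le> 2" using abs_inner_le_1[OF x'(1) y] by (auto simp: v_def abs_le_iff)
      have "z = (2 * \<rho>\<^sup>2) ^ \<beta> / 2 * (v ^ \<beta> * (ln 2 - tau \<beta> j lam) + v ^ \<beta> * ln v)"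
        unfolding x(2) x'(2) g on_S[OF x'(1) y] v_def by (simp add: algebra_simps)
      then have "norm z = \<bar>(2 * \<rho>\<^sup>2) ^ \<beta> / 2\<bar> * \<bar>v ^ \<beta> * (ln 2 - tau \<beta> j lam) + v ^ \<beta> * ln v\<bar>"
        by (simp only: real_norm_def abs_mult)
      also have "\<bar>v ^ \<beta> * (ln 2 - tau \<beta> j lam) + v ^ \<beta> * ln v\<bar> \<le>
          2 ^ \<beta> * \<bar>ln 2 - tau \<beta> j lam\<bar> + 2 ^ (\<beta> + 1)"
        using v \<beta> by (intro order_trans[OF abs_triangle_ineq] add_mono abs_power_mult_ln_le)
          (auto simp: abs_mult intro!: mult_right_mono power_mono)
      finally show "norm z \<le> \<bar>(2 * \<rho>\<^sup>2) ^ \<beta> / 2\<bar> * (2 ^ \<beta> * \<bar>ln 2 - tau \<beta> j lam\<bar> + 2 ^ (\<beta> + 1))"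
        by (simp add: mult_left_mono)
    qed
    have "(\<integral>x. of_real (g (\<rho> *\<^sub>R x)) * h x \<partial>sphere_measure) =
      (\<integral>x. of_real ((2 * \<rho>\<^sup>2) ^ \<beta> / 2) * (of_real ((1 - x \<bullet> y) ^ \<beta> *
        (ln 2 - tau \<beta> j lam + ln (1 - x \<bullet> y))) * h x) \<partial>sphere_measure)"
    proof (rule integral_sphere_measure_cong)
      show "(\<lambda>x. complex_of_real (g (\<rho> *\<^sub>R x)) * h x) \<in> borel_measurable borel"
        using meas by measurable
    qed (auto simp: g on_S y)
    also have "\<dots> = 0"
      using log_kernel_annihilated[OF y ab d \<beta> j] by (simp add: h_def assms(1,5))
    finally show "(\<integral>x. of_real (g (\<rho> *\<^sub>R x)) * h x \<partial>sphere_measure) = 0" .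
  next
    let ?f = "zero_ext S (\<lambda>x. ((x /\<^sub>R \<rho>) \<bullet> a) ^ j)"
    have cont: "continuous_on S ?f"
      by (rule continuous_on_eq[of _ "\<lambda>x. ((x /\<^sub>R \<rho>) \<bullet> a) ^ j"])
        (auto simp: zero_ext_def intro!: continuous_intros)
    then show "?f \<in> cont_functions S" by (simp add: cont_functions_def zero_ext_def)
    show "bounded (?f ` S)"
      by (intro compact_imp_bounded compact_continuous_image cont) (simp add: S)
    show meas: "?f \<in> borel_measurable borel" unfolding zero_ext_def by measurable
    have "(\<integral>x. of_real (?f (\<rho> *\<^sub>R x)) * h x \<partial>sphere_measure) =
      (\<integral>x. of_real ((x \<bullet> a) ^ j) * Complex (x \<bullet> a) (x \<bullet> b) ^ j \<partial>sphere_measure)"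
    proof (rule integral_sphere_measure_cong)
      show "(\<lambda>x. complex_of_real (?f (\<rho> *\<^sub>R x)) * h x) \<in> borel_measurable borel"
        using meas by measurable
      have "?f (\<rho> *\<^sub>R x) = (x \<bullet> a) ^ j" if "norm x = 1" for x
        using that \<rho> by (simp add: zero_ext_def S inner_scaleR_left[symmetric] del: inner_scaleR_left)
      then show "complex_of_real (?f (\<rho> *\<^sub>R x)) * h x =
          of_real ((x \<bullet> a) ^ j) * Complex (x \<bullet> a) (x \<bullet> b) ^ j" if "norm x = 1" for x
        using that by (simp only: h_def)
    qed measurable
    \<comment> \<open>evaluation at the pole \<open>y = a\<close>, where the harmonic takes the value 1\<close>
    also have "\<dots> = of_real (ultraspherical_const a j * beta_moment (real j + (real CARD('n) - 1) / 2) 0)"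
      using monomial_funk_hecke[OF ab(1) ab(1) ab d, of j j] ab
      by (simp add: norm_eq_1 flip: one_complex.code)
    also have "\<dots> \<noteq> 0"
      using ultraspherical_const_pos[OF ab(1) d] beta_moment_pos[OF half_dimension_pos[OF d]]
      by (metis less_irrefl mult_eq_0_iff of_real_eq_0_iff)
    finally show "(\<integral>x. of_real (?f (\<rho> *\<^sub>R x)) * h x \<partial>sphere_measure) \<noteq> 0" .
  qed auto
qed

end
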